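(* Let $k$ and $\ell$ be integers with $k\ge 3$, $\ell\ge 2(k-1)^2$ and $k\nmid \ell$. Let $d$ be the smallest positive integer that divides $k$ but does not divide $\ell$. Then the maximum number of copies of $\overrightarrow{C}_k$ in an $n$-vertex directed graph containing no copy of $\overrightarrow{C}_\ell$ is equal to $\frac{n}{k}\left(\frac{n}{d}\right)^{k-1}+o(n^k)$.
   Context: A directed graph here is a loopless digraph in which each ordered pair of distinct vertices may or may not be an arc; in particular both arcs $uv$ and $vu$ (a digon) may be present. $\overrightarrow{C}_m$ denotes the directed cycle of length $m$. A copy of $H$ in $G$ is a (not necessarily induced) subgraph isomorphic to $H$. Asymptotics are as $n\to\infty$ with $k,\ell$ fixed. *)

theory Defs
  imports
    Complex_Main
    "HOL-Library.Landau_Symbols"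
    "Graph_Theory.Pair_Digraph"
    "Graph_Theory.Digraph_Isomorphism"
begin

definition dicycle :: "nat \<Rightarrow> nat pair_pre_digraph" where
  "dicycle m = \<lparr> pverts = {..<m}, parcs = {(i, Suc i mod m) |i. i < m} \<rparr>"

definition copies :: "'b pair_pre_digraph \<Rightarrow> 'a pair_pre_digraph \<Rightarrow> 'a pair_pre_digraph set" where
  "copies H G = {K. subgraph (with_proj K) (with_proj G) \<and> digraph_iso (with_proj K) (with_proj H)}"

text \<open>
  Every finite digraph is isomorphic to one whose vertices are natural numbers, so nothing is lost
  by taking the maximum over such digraphs only. The locale \<^locale>\<open>pair_digraph\<close> forbids loops
  and, arcs being ordered pairs, parallel arcs; digons are allowed.
\<close>

definition free_copy_counts ::
    "'b pair_pre_digraph \<Rightarrow> 'c pair_pre_digraph \<Rightarrow> nat \<Rightarrow> nat set" where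
  "free_copy_counts H F n =
    {card (copies H G) |G :: nat pair_pre_digraph.
       pair_digraph G \<and> card (pverts G) = n \<and> copies F G = {}}"

definition max_copies ::
    "'b pair_pre_digraph \<Rightarrow> 'c pair_pre_digraph \<Rightarrow> nat \<Rightarrow> nat" where
  "max_copies H F n = Max (free_copy_counts H F n)"

text \<open>The maximum is taken over a finite set, which is nonempty if \<open>F\<close> is a directed cycle.\<close>

lemma finite_free_copy_counts: "finite (free_copy_counts H F n)"
proof -
  have "card (copies H G) \<le> 2 ^ n * 2 ^ (n * n)"
    if G: "pair_digraph G" and n: "card (pverts G) = n" for G :: "nat pair_pre_digraph"
  proof -
    interpret pair_digraph G by (fact G)
    let ?f = "\<lambda>(V, A). \<lparr> pverts = V, parcs = A \<rparr> :: nat pair_pre_digraph"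
    let ?S = "Pow (pverts G) \<times> Pow (pverts G \<times> pverts G)"
    have fin: "finite ?S" by (simp add: pair_finite_verts)
    have "copies H G \<subseteq> ?f ` ?S"
    proof
      fix K assume "K \<in> copies H G"
      then have "pverts K \<subseteq> pverts G" "parcs K \<subseteq> parcs G"
        by (auto simp: copies_def subgraph_def)
      moreover have "parcs G \<subseteq> pverts G \<times> pverts G"
        by (auto dest: in_arcsD1 in_arcsD2)
      ultimately have "(pverts K, parcs K) \<in> ?S" by blast
      moreover have "K = ?f (pverts K, parcs K)" by simp
      ultimately show "K \<in> ?f ` ?S" by (rule rev_image_eqI)
    qed
    then have "card (copies H G) \<le> card ?S"
      using fin by (meson card_image_le card_mono finite_imageI le_trans)
    also have "\<dots> = 2 ^ n * 2 ^ (n * n)"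
      by (simp add: card_cartesian_product card_Pow pair_finite_verts n)
    finally show ?thesis .
  qed
  then have "free_copy_counts H F n \<subseteq> {..2 ^ n * 2 ^ (n * n)}"
    by (auto simp: free_copy_counts_def)
  then show ?thesis by (rule finite_subset) simp
qed

lemma free_copy_counts_dicycle_nonempty:
  assumes "0 < m"
  shows "free_copy_counts H (dicycle m) n \<noteq> {}"
proof -
  let ?G = "\<lparr> pverts = {..<n}, parcs = {} \<rparr> :: nat pair_pre_digraph"
  have "pair_digraph ?G" by unfold_locales auto
  moreover have "(0, Suc 0 mod m) \<in> parcs (dicycle m)" using assms by (auto simp: dicycle_def)
  then have "parcs (dicycle m) \<noteq> {}" by blast
  then have "copies (dicycle m) ?G = {}"
    by (auto simp: copies_def subgraph_def digraph_iso_def app_iso_def with_proj_def)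
  ultimately show ?thesis by (force simp: free_copy_counts_def)
qed

end

theory Submission
  imports Defs "HOL-Number_Theory.Cong" "HOL-Real_Asymp.Real_Asymp"
begin

text \<open>
  The lower bound comes from the balanced blow-up of the directed \<open>d\<close>-cycle, all of whose closed walks
  have length divisible by \<open>d\<close>.

  For the upper bound suppose first that there is not even a closed walk of length \<open>l\<close>. If an arc from a
  closed \<open>k\<close>-walk \<open>C\<close> to a vertex \<open>x\<close> lies on a closed \<open>k\<close>-walk, one can return from \<open>x\<close> to \<open>C\<close> in \<open>k - 1\<close>
  steps; by the Frobenius coin bound for \<open>k\<close> and a number at most \<open>2 * k - 1\<close>, two such arcs leave \<open>C\<close> at
  positions whose difference has a common divisor with \<open>k\<close> of size at least \<open>d\<close>, so \<open>x\<close> receives at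
  most \<open>k / d\<close> of them. Hence out-degrees along \<open>C\<close> average at most \<open>n / d\<close>, and comparing with a
  random walk bounds the number of closed \<open>k\<close>-walks by \<open>n * (n / d) ^ (k - 1)\<close>.

  In general, take a random \<open>m\<close>-tuple of vertices. If it spanned a closed \<open>l\<close>-walk with positive
  probability, some fixed walk pattern would occur on a box of tuples, and distinct choices inside the
  box would form an \<open>l\<close>-cycle. So almost every tuple obeys the bound above; average and let \<open>m\<close> grow.
\<close>

section \<open>Closed walks and relational powers\<close>

text \<open>A closed walk carries its starting point and may repeat vertices. The distinct lists
  among them are the genuine cycles, each listed once per starting point.\<close>

definition closed_walks :: "'a rel \<Rightarrow> nat \<Rightarrow> 'a list set" where
  "closed_walks E k = {xs. length xs = k \<and> (\<forall>i<k. (xs ! i, xs ! (Suc i mod k)) \<in> E)}"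

lemma closed_walks_nth:
  "xs \<in> closed_walks E k \<Longrightarrow> i < k \<Longrightarrow> (xs ! i, xs ! (Suc i mod k)) \<in> E"
  by (simp add: closed_walks_def)

lemma closed_walks_subset_lists:
  assumes "E \<subseteq> V \<times> V"
  shows "closed_walks E k \<subseteq> {xs. set xs \<subseteq> V \<and> length xs = k}"
  using assms by (force simp: closed_walks_def in_set_conv_nth)

lemma finite_closed_walks:
  assumes "finite V" "E \<subseteq> V \<times> V"
  shows "finite (closed_walks E k)"
  using closed_walks_subset_lists[OF assms(2)] finite_lists_length_eq[OF assms(1)]
  by (rule finite_subset)

lemma closed_walks_relpow:
  assumes "xs \<in> closed_walks E k" "i < k"
  shows "(xs ! i, xs ! ((i + n) mod k)) \<in> E ^^ n"
proof (induction n)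
  case 0
  then show ?case using assms by simp
next
  case (Suc n)
  have "(i + n) mod k < k" using assms by simp
  then have "(xs ! ((i + n) mod k), xs ! (Suc ((i + n) mod k) mod k)) \<in> E"
    using assms by (auto simp: closed_walks_def)
  with Suc show ?case by (auto simp: mod_Suc_eq)
qed

lemma closed_walks_nonempty_iff:
  assumes "0 < l"
  shows "closed_walks E l \<noteq> {} \<longleftrightarrow> (\<exists>u. (u, u) \<in> E ^^ l)"
proof
  assume "closed_walks E l \<noteq> {}"
  then obtain xs where "xs \<in> closed_walks E l" by blast
  from closed_walks_relpow[OF this assms, of l] show "\<exists>u. (u, u) \<in> E ^^ l" by auto
next
  assume "\<exists>u. (u, u) \<in> E ^^ l"
  then obtain f where f: "f 0 = f l" "\<forall>i<l. (f i, f (Suc i)) \<in> E"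
    by (metis relpow_fun_conv)
  have "f (Suc i mod l) = f (Suc i)" if "i < l" for i
    using that f(1) by (cases "Suc i = l") auto
  then have "map f [0..<l] \<in> closed_walks E l"
    using f by (auto simp: closed_walks_def)
  then show "closed_walks E l \<noteq> {}" by blast
qed

text \<open>Rotating a list of length \<open>k\<close> as many as \<open>k\<close> times is the
  identity, so rotating \<open>k - 1\<close> times inverts \<open>rotate1\<close>.\<close>

lemma bij_betw_rotate1_closed_walks:
  "bij_betw rotate1 (closed_walks E k) (closed_walks E k)"
proof (rule bij_betwI')
  fix xs ys :: "'a list"
  show "rotate1 xs = rotate1 ys \<longleftrightarrow> xs = ys"
    using inj_rotate1 by (auto dest: injD)
next
  fix xs assume "xs \<in> closed_walks E k"
  then show "rotate1 xs \<in> closed_walks E k"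
    by (cases "k = 0") (auto simp: closed_walks_def nth_rotate1)
next
  fix ys assume ys: "ys \<in> closed_walks E k"
  have *: "rotate n ys \<in> closed_walks E k" for n
  proof -
    have "(ys ! ((n + i) mod k), ys ! (Suc ((n + i) mod k) mod k)) \<in> E" if "i < k" for i
      using ys that by (auto simp: closed_walks_def)
    then show ?thesis
      using ys by (auto simp: closed_walks_def nth_rotate mod_Suc_eq mod_simps)
  qed
  show "\<exists>xs\<in>closed_walks E k. ys = rotate1 xs"
  proof (cases "k = 0")
    case True
    then show ?thesis using ys by (auto simp: closed_walks_def)
  next
    case False
    have "rotate1 (rotate (k - 1) ys) = rotate k ys"
      using False by (metis rotate_Suc Suc_pred' neq0_conv)
    also have "\<dots> = ys" using ys by (auto simp: closed_walks_def)
    finally show ?thesis using *[of "k - 1"] by metis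
  qed
qed

text \<open>Moving the starting point permutes the closed walks, so in a uniformly random one all
  positions are equally distributed.\<close>

lemma sum_closed_walks_nth:
  fixes z :: "'a \<Rightarrow> real"
  assumes "i < k"
  shows "(\<Sum>xs\<in>closed_walks E k. z (xs ! i)) = (\<Sum>xs\<in>closed_walks E k. z (xs ! 0))"
  using assms
proof (induction i)
  case (Suc i)
  have "(\<Sum>xs\<in>closed_walks E k. z (xs ! i)) = (\<Sum>xs\<in>closed_walks E k. z (rotate1 xs ! i))"
    by (rule sum.reindex_bij_betw[OF bij_betw_rotate1_closed_walks, symmetric])
  also have "\<dots> = (\<Sum>xs\<in>closed_walks E k. z (xs ! Suc i))"
    using Suc.prems by (intro sum.cong) (auto simp: closed_walks_def nth_rotate1)
  finally show ?case using Suc by simp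
qed simp

section \<open>The coin problem and closed walks through one vertex\<close>

text \<open>The Frobenius coin bound. Solving modulo \<open>p\<close> gives a coefficient
  \<open>b < p\<close> of \<open>q\<close>; then \<open>q * b\<close> is less than
  \<open>n + p\<close> and congruent to \<open>n\<close>, hence at most \<open>n\<close>, and the
  rest is a multiple of \<open>p\<close>.\<close>

lemma coprime_representable:
  fixes p q n :: nat
  assumes "coprime p q" "0 < p" "(p - 1) * (q - 1) \<le> n"
  shows "\<exists>a b. n = a * p + b * q"
proof -
  obtain x where x: "[q * x = 1] (mod p)"
    using assms(1) cong_solve_coprime_nat[of q p] by (auto simp: coprime_commute)
  define b where "b = (x * n) mod p"
  have "[q * b = q * (x * n)] (mod p)"
    unfolding b_def by (intro cong_mult cong_refl) simp
  also have "q * (x * n) = (q * x) * n" by simp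
  also have "[(q * x) * n = 1 * n] (mod p)" by (intro cong_mult x cong_refl)
  finally have cong: "[q * b = n] (mod p)" by simp
  have "b < p" using assms(2) by (simp add: b_def)
  then have "q * b \<le> q * (p - 1)" by (intro mult_le_mono) auto
  moreover have "q * (p - 1) < n + p"
    using assms(2,3) by (cases q; cases p) (auto simp: algebra_simps)
  ultimately have less: "q * b < n + p" by linarith
  have "q * b \<le> n"
  proof (rule ccontr)
    \<comment> \<open>The excess of \<open>q * b\<close> over \<open>n\<close> would be a positive
      multiple of \<open>p\<close> smaller than \<open>p\<close>.\<close>
    assume "\<not> q * b \<le> n"
    then have "p dvd q * b - n"
      using cong by (metis cong_altdef_nat nat_le_linear)
    then have "p \<le> q * b - n" using \<open>\<not> q * b \<le> n\<close> by (intro dvd_imp_le) auto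
    with less \<open>\<not> q * b \<le> n\<close> show False by linarith
  qed
  then have "p dvd n - q * b"
    using cong by (metis cong_altdef_nat cong_sym)
  then obtain a where "n - q * b = p * a" by blast
  then have "n = a * p + b * q" using \<open>q * b \<le> n\<close> by (simp add: algebra_simps)
  then show ?thesis by blast
qed

lemma relpow_refl_mult: "(u, u) \<in> E ^^ k \<Longrightarrow> (u, u) \<in> E ^^ (a * k)"
  by (induction a) (auto simp: relpow_add)

text \<open>After division by the gcd the coin bound writes \<open>l\<close> as a combination of
  \<open>k\<close> and \<open>a\<close>; the two closed walks are then traversed that many times.
  The undivided bound on \<open>l\<close> is strong enough because one factor absorbs the
  gcd.\<close>

lemma relpow_refl_gcd:
  assumes "(u, u) \<in> E ^^ k" "(u, u) \<in> E ^^ a" "0 < k" "0 < a"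
    and "gcd k a dvd l" "(k - 1) * (a - 1) \<le> l"
  shows "(u, u) \<in> E ^^ l"
proof -
  define g where "g = gcd k a"
  have g: "0 < g" using assms by (simp add: g_def)
  obtain k' a' where ka: "k = g * k'" "a = g * a'" "coprime k' a'"
    using assms(3) gcd_coprime_exists[of k a] g by (metis g_def mult.commute neq0_conv)
  obtain l' where l': "l = g * l'" using assms by (auto simp: g_def)
  have pos: "0 < k'" "0 < a'" using ka assms by (auto intro: Nat.gr0I)
  have "g * ((k' - 1) * (a' - 1)) \<le> (k - 1) * (a - 1)"
  proof -
    have "g * (k' - 1) \<le> k - 1" using ka g pos by (auto simp: algebra_simps)
    moreover have "a' - 1 \<le> a - 1" unfolding ka(2) using g by (intro diff_le_mono) simp
    ultimately have "(g * (k' - 1)) * (a' - 1) \<le> (k - 1) * (a - 1)" by (rule mult_le_mono)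
    then show ?thesis by (simp add: algebra_simps)
  qed
  also have "\<dots> \<le> g * l'" using assms l' by simp
  finally have "(k' - 1) * (a' - 1) \<le> l'" using g by simp
  then obtain x y where "l' = x * k' + y * a'"
    using coprime_representable[OF ka(3) pos(1)] by blast
  then have "l = x * k + y * a" by (simp add: l' ka algebra_simps)
  then show ?thesis
    using relpow_refl_mult[OF assms(1), of x] relpow_refl_mult[OF assms(2), of y]
    by (auto simp: relpow_add)
qed

text \<open>
  Two such neighbours at positions \<open>i < j\<close> give closed walks of lengths \<open>k\<close> and \<open>k + (j - i)\<close> through
  the same vertex, so \<open>gcd k (j - i)\<close> cannot divide \<open>l\<close>.
\<close>

lemma card_in_neighbours_closed_walk:
  assumes xs: "xs \<in> closed_walks E k" and no: "\<And>u. (u, u) \<notin> E ^^ l"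
    and l: "2 * (k - 1)\<^sup>2 \<le> l" and ndvd: "\<not> k dvd l"
    and d: "\<And>g. g dvd k \<Longrightarrow> \<not> g dvd l \<Longrightarrow> d \<le> g"
  shows "card {i. i < k \<and> (xs ! i, x) \<in> E \<and> (x, xs ! i) \<in> E ^^ (k - 1)} * d \<le> k"
proof -
  let ?I = "{i. i < k \<and> (xs ! i, x) \<in> E \<and> (x, xs ! i) \<in> E ^^ (k - 1)}"
  have gap: "d \<le> gcd k (j - i)" if I: "i \<in> ?I" "j \<in> ?I" and ij: "i < j" for i j
  proof (rule d)
    show "gcd k (j - i) dvd k" by simp
    show "\<not> gcd k (j - i) dvd l"
    proof
      assume g: "gcd k (j - i) dvd l"
      \<comment> \<open>The longer closed walk follows \<open>xs\<close> from position
        \<open>i\<close> to \<open>j\<close>, steps to \<open>x\<close>, and returns to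
        \<open>xs ! i\<close> in \<open>k - 1\<close> steps.\<close>
      have "(xs ! i, xs ! ((i + (j - i)) mod k)) \<in> E ^^ (j - i)"
        using xs I by (intro closed_walks_relpow) auto
      then have 1: "(xs ! i, xs ! j) \<in> E ^^ (j - i)" using ij I by simp
      have "(xs ! j, xs ! i) \<in> E ^^ (1 + (k - 1))"
        using I by (subst relpow_add) auto
      with 1 have "(xs ! i, xs ! i) \<in> E ^^ (j - i + (1 + (k - 1)))"
        by (subst relpow_add) blast
      moreover have "j - i + (1 + (k - 1)) = k + (j - i)" using I by auto
      ultimately have 2: "(xs ! i, xs ! i) \<in> E ^^ (k + (j - i))" by metis
      have "(xs ! i, xs ! ((i + k) mod k)) \<in> E ^^ k"
        using xs I by (intro closed_walks_relpow) auto
      then have 3: "(xs ! i, xs ! i) \<in> E ^^ k" using I by simp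
      \<comment> \<open>As \<open>j - i\<close> is at most \<open>k - 1\<close>, the coin bound is
        at most \<open>2 * (k - 1)\<^sup>2\<close>, the assumed lower bound on
        \<open>l\<close>.\<close>
      have "(k - 1) * (k + (j - i) - 1) \<le> (k - 1) * (2 * (k - 1))"
        using I ij by (intro mult_le_mono) auto
      also have "\<dots> \<le> l" using l by (simp add: power2_eq_square algebra_simps)
      finally have "(xs ! i, xs ! i) \<in> E ^^ l"
        using I g by (intro relpow_refl_gcd[OF 3 2]) (auto simp: gcd_add2)
      with no show False by blast
    qed
  qed
  \<comment> \<open>Blocks of \<open>d\<close> cyclically consecutive residues starting at the
    elements of \<open>?I\<close> are disjoint, so they fit into \<open>k\<close> residues. If two
    blocks met, \<open>gcd k (j - i)\<close> would divide \<open>t - s\<close>, whose absolute value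
    is below \<open>d\<close>.\<close>
  have "inj_on (\<lambda>(i, t). (i + t) mod k) (?I \<times> {..<d})"
  proof -
    have main: "i = j \<and> t = s"
      if I: "i \<in> ?I" "j \<in> ?I" and ts: "t < d" "s < d" and ij: "i \<le> j"
        and eq: "(i + t) mod k = (j + s) mod k" for i j t s
    proof -
      have "(int i + int t) mod int k = (int j + int s) mod int k"
        using arg_cong[OF eq, of int] by (simp add: zmod_int)
      then have "int k dvd (int i + int t) - (int j + int s)" by (simp only: mod_eq_dvd_iff)
      moreover have "(int j - int i) - (int t - int s) = - ((int i + int t) - (int j + int s))" by simp
      ultimately have k: "int k dvd (int j - int i) - (int t - int s)" by (simp only: dvd_minus_iff)
      show ?thesis
      proof (cases "i = j")
        case True
        have "d \<le> k" using d[of k] ndvd by simp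
        have "int k dvd int t - int s" using k True by (simp add: dvd_diff_commute)
        then have "int t - int s = 0"
          using dvd_imp_le_int[of "int t - int s" "int k"] \<open>d \<le> k\<close> ts by linarith
        then show ?thesis using True by simp
      next
        case False
        with ij have "i < j" by simp
        let ?g = "gcd k (j - i)"
        have g: "d \<le> ?g" using gap I \<open>i < j\<close> by blast
        have "int ?g dvd int k" "int ?g dvd int j - int i"
          using \<open>i < j\<close> by (auto simp flip: of_nat_diff)
        then have "int ?g dvd int t - int s"
          using k by (metis dvd_diff_right_iff dvd_trans)
        then have "int t - int s = 0"
          using dvd_imp_le_int[of "int t - int s" "int ?g"] g ts by linarith
        then have "t = s" by simp
        then have "int k dvd int j - int i" using k by simp
        then show ?thesis using \<open>i < j\<close> I zdvd_imp_le[of "int k" "int j - int i"] by auto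
      qed
    qed
    show ?thesis
    proof (rule inj_onI, clarify)
      fix i t j s
      assume "(i + t) mod k = (j + s) mod k" "t < d" "s < d" "i < k" "j < k"
        "(xs ! i, x) \<in> E" "(x, xs ! i) \<in> E ^^ (k - 1)" "(xs ! j, x) \<in> E" "(x, xs ! j) \<in> E ^^ (k - 1)"
      then show "i = j \<and> t = s"
        using main[of i j t s] main[of j i s t] by (cases "i \<le> j") auto
    qed
  qed
  then have "card (?I \<times> {..<d}) \<le> card {..<k}"
    by (rule card_inj_on_le) (auto intro!: mod_less_divisor)
  then show ?thesis by (simp add: card_cartesian_product)
qed

section \<open>Random walks and the exact bound on closed walks\<close>

lemma sum_lists_Suc:
  fixes f :: "'a list \<Rightarrow> real"
  shows "(\<Sum>xs | set xs \<subseteq> V \<and> length xs = Suc n. f xs)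
    = (\<Sum>x\<in>V. \<Sum>xs | set xs \<subseteq> V \<and> length xs = n. f (x # xs))"
proof -
  have "(\<Sum>xs | set xs \<subseteq> V \<and> length xs = Suc n. f xs)
    = (\<Sum>(x, xs)\<in>V \<times> {xs. set xs \<subseteq> V \<and> length xs = n}. f (x # xs))"
    by (rule sum.reindex_bij_witness[of _ "\<lambda>(x, xs). x # xs" "\<lambda>xs. (hd xs, tl xs)"])
       (auto simp: length_Suc_conv)
  then show ?thesis by (simp add: sum.cartesian_product)
qed

text \<open>If \<open>w\<close> is at most the inverse out-degree, the summands are bounded by the
  probabilities of the walks of \<open>n\<close> steps from \<open>u\<close>. \<open>butlast\<close>
  appears because the final vertex is not left again.\<close>

lemma sum_walk_weights_from:
  fixes w :: "'a \<Rightarrow> real"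
  assumes V: "finite V" and w: "\<And>x. 0 \<le> w x"
    and out: "\<And>x. x \<in> V \<Longrightarrow> real (card {y\<in>V. (x, y) \<in> E}) * w x \<le> 1"
    and "u \<in> V"
  shows "(\<Sum>xs | set xs \<subseteq> V \<and> length xs = n.
      if successively (\<lambda>x y. (x, y) \<in> E) (u # xs) then prod_list (map w (butlast (u # xs))) else 0) \<le> 1"
    (is "?S n u \<le> 1")
  using \<open>u \<in> V\<close>
proof (induction n arbitrary: u)
  case 0
  have "{xs. set xs \<subseteq> V \<and> length xs = 0} = {[]}" by auto
  then show ?case by simp
next
  case (Suc n)
  have "?S (Suc n) u = (\<Sum>y\<in>V. (if (u, y) \<in> E then w u else 0) * ?S n y)"
    unfolding sum_lists_Suc by (auto simp: sum_distrib_left intro!: sum.cong)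
  also have "\<dots> \<le> (\<Sum>y\<in>V. (if (u, y) \<in> E then w u else 0) * 1)"
    using Suc.IH w by (intro sum_mono mult_left_mono) auto
  also have "\<dots> = real (card {y\<in>V. (u, y) \<in> E}) * w u"
    using V by (simp add: sum.If_cases Int_def)
  also have "\<dots> \<le> 1" using Suc.prems by (rule out)
  finally show ?case .
qed

text \<open>Forgetting the closing arc leaves an open walk with \<open>k - 1\<close> steps; each
  starting vertex contributes total weight at most 1.\<close>

lemma sum_closed_walk_weights:
  fixes w :: "'a \<Rightarrow> real"
  assumes V: "finite V" "E \<subseteq> V \<times> V" and w: "\<And>x. 0 \<le> w x"
    and out: "\<And>x. x \<in> V \<Longrightarrow> real (card {y\<in>V. (x, y) \<in> E}) * w x \<le> 1"
    and "0 < k"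
  shows "(\<Sum>xs\<in>closed_walks E k. \<Prod>i<k - 1. w (xs ! i)) \<le> real (card V)"
proof -
  obtain n where k: "k = Suc n" using \<open>0 < k\<close> by (cases k) auto
  let ?f = "\<lambda>xs. if successively (\<lambda>x y. (x, y) \<in> E) xs then prod_list (map w (butlast xs)) else 0"
  have eq: "(\<Prod>i<k - 1. w (xs ! i)) = ?f xs" if xs: "xs \<in> closed_walks E k" for xs
  proof -
    have "(xs ! i, xs ! Suc i) \<in> E" if "Suc i < k" for i
      using xs that by (auto simp: closed_walks_def dest!: spec[of _ i])
    then have "successively (\<lambda>x y. (x, y) \<in> E) xs"
      using xs by (auto simp: closed_walks_def successively_conv_nth)
    moreover have "(\<Prod>i<k - 1. w (xs ! i)) = prod_list (map w (butlast xs))"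
      using xs unfolding prod.list_conv_set_nth
      by (intro prod.cong) (auto simp: closed_walks_def nth_butlast)
    ultimately show ?thesis by simp
  qed
  have "(\<Sum>xs\<in>closed_walks E k. \<Prod>i<k - 1. w (xs ! i)) = (\<Sum>xs\<in>closed_walks E k. ?f xs)"
    by (intro sum.cong eq refl)
  also have "\<dots> \<le> (\<Sum>xs | set xs \<subseteq> V \<and> length xs = k. ?f xs)"
    using V w by (intro sum_mono2 finite_lists_length_eq closed_walks_subset_lists)
      (auto intro!: prod_list_nonneg)
  also have "\<dots> \<le> (\<Sum>x\<in>V. 1)"
    unfolding k sum_lists_Suc using V w out by (intro sum_mono sum_walk_weights_from) auto
  finally show ?thesis by simp
qed

text \<open>Both inequalities come from \<open>1 + t \<le> exp t\<close>, used once for the whole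
  sum and once for each factor with \<open>t = z i - 1\<close>.\<close>

lemma one_plus_sum_le_inverse_prod:
  fixes z :: "'i \<Rightarrow> real"
  assumes "\<And>i. i \<in> A \<Longrightarrow> 0 < z i"
  shows "1 + (\<Sum>i\<in>A. 1 - z i) \<le> (\<Prod>i\<in>A. inverse (z i))"
proof (cases "finite A")
  case True
  have "1 + (\<Sum>i\<in>A. 1 - z i) \<le> exp (\<Sum>i\<in>A. 1 - z i)" by (rule exp_ge_add_one_self)
  also have "\<dots> = (\<Prod>i\<in>A. exp (1 - z i))" using True by (rule exp_sum)
  also have "\<dots> \<le> (\<Prod>i\<in>A. inverse (z i))"
  proof (intro prod_mono conjI)
    fix i assume "i \<in> A"
    have "z i \<le> exp (z i - 1)" using exp_ge_add_one_self[of "z i - 1"] by simp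
    then have "inverse (exp (z i - 1)) \<le> inverse (z i)"
      using assms[OF \<open>i \<in> A\<close>] by (intro le_imp_inverse_le)
    then show "exp (1 - z i) \<le> inverse (z i)" by (simp flip: exp_minus)
  qed simp
  finally show ?thesis .
qed simp

text \<open>
  A random walk that moves to a uniformly random out-neighbour, along arcs lying on closed \<open>k\<close>-walks
  only, follows a given closed walk with probability the product of the inverse out-degrees. On
  average along a closed walk the out-degree is at most \<open>card V / d\<close>.
\<close>

lemma card_closed_walks_le:
  assumes V: "finite V" "E \<subseteq> V \<times> V" and no: "\<And>u. (u, u) \<notin> E ^^ l"
    and l: "2 * (k - 1)\<^sup>2 \<le> l" and ndvd: "\<not> k dvd l" and "0 < k" "0 < d"
    and d: "\<And>g. g dvd k \<Longrightarrow> \<not> g dvd l \<Longrightarrow> d \<le> g"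
  shows "real (card (closed_walks E k)) \<le> real (card V) * (real (card V) / real d) ^ (k - 1)"
proof (cases "V = {}")
  case True
  then have "closed_walks E k = {}" using V \<open>0 < k\<close> by (auto simp: closed_walks_def)
  then show ?thesis by simp
next
  case False
  define m where "m = real (card V)"
  have m: "0 < m" using False V by (simp add: m_def card_gt_0_iff)
  \<comment> \<open>Closed \<open>k\<close>-walks use only these arcs, and the return walk required
    by the in-neighbour bound is built in.\<close>
  define E' where "E' = {(x, y) \<in> E. (y, x) \<in> E ^^ (k - 1)}"
  have E': "E' \<subseteq> V \<times> V" using V by (auto simp: E'_def)
  define D where "D x = real (card {y\<in>V. (x, y) \<in> E'})" for x
  \<comment> \<open>The out-degree in units of the target value \<open>m / d\<close>.\<close>
  define z where "z x = D x * d / m" for x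
  let ?W = "closed_walks E k"
  have W: "finite ?W" using V by (rule finite_closed_walks)
  have arc: "(xs ! i, xs ! (Suc i mod k)) \<in> E'" if xs: "xs \<in> ?W" "i < k" for xs i
  proof -
    have *: "Suc i mod k < k" using \<open>0 < k\<close> by simp
    have "(Suc i mod k + (k - 1)) mod k = (Suc i + (k - 1)) mod k" by (rule mod_add_left_eq)
    also have "Suc i + (k - 1) = i + k" using \<open>0 < k\<close> by simp
    finally have "(xs ! (Suc i mod k), xs ! i) \<in> E ^^ (k - 1)"
      using closed_walks_relpow[OF xs(1) *, of "k - 1"] xs(2) by simp
    then show ?thesis using xs by (auto simp: E'_def closed_walks_def)
  qed
  then have WE': "?W \<subseteq> closed_walks E' k" by (auto simp: closed_walks_def)
  have D_pos: "0 < D (xs ! i)" if "xs \<in> ?W" "i < k" for xs i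
    using arc[OF that] E' V by (auto simp: D_def card_gt_0_iff)
  have avg: "(\<Sum>i<k. z (xs ! i)) \<le> real k" if xs: "xs \<in> ?W" for xs
  proof -
    \<comment> \<open>Count the arcs leaving the walk by their heads: each head receives at most
      \<open>k / d\<close> of them.\<close>
    have "(\<Sum>i<k. D (xs ! i)) = (\<Sum>i<k. \<Sum>y\<in>V. if (xs ! i, y) \<in> E' then 1 else 0)"
      using V by (simp add: D_def sum.If_cases Int_def)
    also have "\<dots> = (\<Sum>y\<in>V. \<Sum>i<k. if (xs ! i, y) \<in> E' then 1 else 0)" by (rule sum.swap)
    also have "\<dots> = (\<Sum>y\<in>V. real (card {i. i < k \<and> (xs ! i, y) \<in> E'}))"
      by (simp add: sum.If_cases Int_def)
    finally have "(\<Sum>i<k. D (xs ! i)) * d = (\<Sum>y\<in>V. real (card {i. i < k \<and> (xs ! i, y) \<in> E'} * d))"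
      by (simp add: sum_distrib_right)
    also have "\<dots> \<le> (\<Sum>y\<in>V. real k)"
      using card_in_neighbours_closed_walk[OF xs no l ndvd d]
      by (intro sum_mono) (simp add: E'_def del: of_nat_mult)
    finally have "(\<Sum>i<k. D (xs ! i)) * d \<le> m * k" by (simp add: m_def)
    then have "(\<Sum>i<k. D (xs ! i)) * d / m \<le> k" using m by (simp add: field_simps)
    then show ?thesis by (simp add: z_def sum_distrib_right sum_divide_distrib)
  qed
  have first: "(\<Sum>xs\<in>?W. z (xs ! 0)) \<le> card ?W"
  proof -
    have "(\<Sum>i<k. \<Sum>xs\<in>?W. z (xs ! i)) = (\<Sum>i<k. \<Sum>xs\<in>?W. z (xs ! 0))"
      by (intro sum.cong sum_closed_walks_nth) auto
    then have "k * (\<Sum>xs\<in>?W. z (xs ! 0)) = (\<Sum>i<k. \<Sum>xs\<in>?W. z (xs ! i))" by simp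
    also have "\<dots> = (\<Sum>xs\<in>?W. \<Sum>i<k. z (xs ! i))" by (rule sum.swap)
    also have "\<dots> \<le> (\<Sum>xs\<in>?W. real k)" by (intro sum_mono avg)
    finally show ?thesis using \<open>0 < k\<close> by simp
  qed
  \<comment> \<open>The added term is nonnegative because \<open>z\<close> averages at most 1.
    Spread over the first \<open>k - 1\<close> positions, it is the first-order part of the product
    of the inverses of \<open>z\<close>.\<close>
  have "real (card ?W) \<le> card ?W + (k - 1) * (card ?W - (\<Sum>xs\<in>?W. z (xs ! 0)))"
    using first by simp
  also have "\<dots> = card ?W + (\<Sum>i<k - 1. \<Sum>xs\<in>?W. 1 - z (xs ! 0))"
    by (simp add: sum_subtractf)
  also have "(\<Sum>i<k - 1. \<Sum>xs\<in>?W. 1 - z (xs ! 0)) = (\<Sum>i<k - 1. \<Sum>xs\<in>?W. 1 - z (xs ! i))"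
    by (intro sum.cong sum_closed_walks_nth[of _ k "\<lambda>x. 1 - z x", symmetric]) auto
  also have "\<dots> = (\<Sum>xs\<in>?W. \<Sum>i<k - 1. 1 - z (xs ! i))" by (rule sum.swap)
  also have "card ?W + \<dots> = (\<Sum>xs\<in>?W. 1 + (\<Sum>i<k - 1. 1 - z (xs ! i)))"
    by (simp add: sum.distrib)
  also have "\<dots> \<le> (\<Sum>xs\<in>?W. \<Prod>i<k - 1. inverse (z (xs ! i)))"
    using D_pos m \<open>0 < d\<close> by (intro sum_mono one_plus_sum_le_inverse_prod) (auto simp: z_def)
  also have "\<dots> = (\<Sum>xs\<in>?W. (m / d) ^ (k - 1) * (\<Prod>i<k - 1. inverse (D (xs ! i))))"
    by (simp add: z_def prod_dividef prod.distrib divide_inverse power_mult_distrib power_inverse ac_simps)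
  also have "\<dots> = (m / d) ^ (k - 1) * (\<Sum>xs\<in>?W. \<Prod>i<k - 1. inverse (D (xs ! i)))"
    by (simp add: sum_distrib_left)
  also have "\<dots> \<le> (m / d) ^ (k - 1) * m"
  proof (rule mult_left_mono)
    have "(\<Sum>xs\<in>?W. \<Prod>i<k - 1. inverse (D (xs ! i)))
        \<le> (\<Sum>xs\<in>closed_walks E' k. \<Prod>i<k - 1. inverse (D (xs ! i)))"
      using WE' V E' by (intro sum_mono2 finite_closed_walks) (auto intro!: prod_nonneg simp: D_def)
    also have "\<dots> \<le> m" unfolding m_def
      using V E' \<open>0 < k\<close> by (intro sum_closed_walk_weights) (auto simp: D_def right_inverse_eq divide_inverse[symmetric])
    finally show "(\<Sum>xs\<in>?W. \<Prod>i<k - 1. inverse (D (xs ! i))) \<le> m" .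
  qed (use m in simp)
  finally show ?thesis by (simp add: m_def mult.commute)
qed

section \<open>Boxes inside dense sets of tuples\<close>

text \<open>Greedy choice: fewer than \<open>n\<close> elements are taken before each step, so none
  of the sets is exhausted.\<close>

lemma distinct_representatives:
  assumes "\<And>i. i < n \<Longrightarrow> n \<le> card (A i)"
  shows "\<exists>ys. length ys = n \<and> distinct ys \<and> (\<forall>i<n. ys ! i \<in> A i)"
proof -
  have "\<exists>ys. length ys = j \<and> distinct ys \<and> (\<forall>i<j. ys ! i \<in> A i)" if "j \<le> n" for j
    using that
  proof (induction j)
    case (Suc j)
    then obtain ys where ys: "length ys = j" "distinct ys" "\<forall>i<j. ys ! i \<in> A i" by auto
    have "\<not> A j \<subseteq> set ys"
    proof
      assume "A j \<subseteq> set ys"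
      then have "card (A j) \<le> card (set ys)" by (intro card_mono) auto
      also have "\<dots> \<le> j" using ys card_length by metis
      finally show False using assms[of j] Suc.prems by simp
    qed
    then obtain y where "y \<in> A j" "y \<notin> set ys" by blast
    then have "length (ys @ [y]) = Suc j \<and> distinct (ys @ [y]) \<and> (\<forall>i<Suc j. (ys @ [y]) ! i \<in> A i)"
      using ys by (auto simp: nth_append less_Suc_eq)
    then show ?case by blast
  qed simp
  then show ?thesis by blast
qed

lemma listset_iff_nth:
  "xs \<in> listset Ts \<longleftrightarrow> length xs = length Ts \<and> (\<forall>i<length Ts. xs ! i \<in> Ts ! i)"
proof -
  have "xs \<in> listset Ts \<longleftrightarrow> list_all2 (\<in>) xs Ts"
    by (induction Ts arbitrary: xs) (auto simp: set_Cons_def list_all2_Cons2)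
  then show ?thesis by (auto simp: list_all2_conv_all_nth)
qed

text \<open>
  To split off the first coordinate, restrict it to a set \<open>S\<close> of bounded size consisting of elements
  with many extensions; then one of the boundedly many subsets of \<open>S\<close> is the set of admissible
  first entries for a positive proportion of the remaining tuples.
\<close>

lemma dense_tuples_contain_box:
  fixes e :: real
  assumes "0 < e"
  shows "\<exists>n0. \<forall>V R :: 'a list set. finite V \<longrightarrow> n0 \<le> card V \<longrightarrow> R \<subseteq> {xs. set xs \<subseteq> V \<and> length xs = h} \<longrightarrow>
    e * real (card V) ^ h \<le> real (card R) \<longrightarrow>
    (\<exists>Ts. length Ts = h \<and> (\<forall>T\<in>set Ts. t \<le> card T) \<and> listset Ts \<subseteq> R)"
  using assms
proof (induction h arbitrary: e)
  case 0
  show ?case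
  proof (intro exI[of _ 0] allI impI)
    fix V :: "'a set" and R :: "'a list set"
    assume R: "R \<subseteq> {xs. set xs \<subseteq> V \<and> length xs = 0}" "e * real (card V) ^ 0 \<le> real (card R)"
    have "R \<noteq> {}" using R(2) 0 by auto
    then have "R = {[]}" using R(1) by auto
    then show "\<exists>Ts. length Ts = 0 \<and> (\<forall>T\<in>set Ts. t \<le> card T) \<and> listset Ts \<subseteq> R" by simp
  qed
next
  case (Suc h)
  \<comment> \<open>With this size of \<open>S\<close>, tails with fewer than \<open>t\<close>
    admissible first entries in \<open>S\<close> carry at most half of the guaranteed incidences
    between \<open>S\<close> and the tails.\<close>
  define s where "s = nat \<lceil>4 * (real t + 1) / e\<rceil>"
  have s: "4 * (real t + 1) \<le> e * real s"
  proof -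
    have "4 * (real t + 1) / e \<le> real s" unfolding s_def by (rule real_nat_ceiling_ge)
    then show ?thesis using Suc.prems by (simp add: field_simps)
  qed
  have s0: "0 < s" using s by (intro Nat.gr0I) auto
  \<comment> \<open>The good tails have density at least \<open>e / 4\<close> and are split into
    \<open>2 ^ s\<close> classes; the spare factor 2 makes the pigeonhole contradiction
    strict.\<close>
  define e' where "e' = e / 8 / 2 ^ s"
  have "0 < e'" using Suc.prems by (simp add: e'_def)
  from Suc.IH[OF this] obtain n0 where
    "\<forall>V R :: 'a list set. finite V \<longrightarrow> n0 \<le> card V \<longrightarrow> R \<subseteq> {xs. set xs \<subseteq> V \<and> length xs = h} \<longrightarrow>
      e' * real (card V) ^ h \<le> real (card R) \<longrightarrow>
      (\<exists>Ts. length Ts = h \<and> (\<forall>T\<in>set Ts. t \<le> card T) \<and> listset Ts \<subseteq> R)" ..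
  note n0 = this[rule_format]
  \<comment> \<open>Ensures that the at least \<open>e * n / 2\<close> elements of \<open>X\<close>
    include \<open>s\<close> of them.\<close>
  define n1 where "n1 = max n0 (max 1 (nat \<lceil>2 * real s / e\<rceil>))"
  show ?case
  proof (intro exI[of _ n1] allI impI)
    fix V :: "'a set" and R :: "'a list set"
    assume V: "finite V" "n1 \<le> card V" and R: "R \<subseteq> {xs. set xs \<subseteq> V \<and> length xs = Suc h}"
      and dense: "e * real (card V) ^ Suc h \<le> real (card R)"
    define n where "n = real (card V)"
    have n: "n0 \<le> card V" "0 < n" using V(2) by (auto simp: n1_def n_def)
    have "2 * real s / e \<le> n"
      using V(2) by (auto simp: n1_def n_def intro: order_trans[OF real_nat_ceiling_ge])
    then have ns: "2 * real s \<le> e * n" using Suc.prems by (simp add: field_simps)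
    let ?L = "{xs. set xs \<subseteq> V \<and> length xs = h}"
    have L: "finite ?L" using V by (simp add: finite_lists_length_eq)
    have cL: "real (card ?L) = n ^ h" using V by (simp add: card_lists_length_eq n_def)
    have nh: "0 < n ^ h" using n by simp
    define r where "r x = (\<Sum>ys\<in>?L. of_bool (x # ys \<in> R) :: real)" for x
    have r_le: "r x \<le> n ^ h" for x
    proof -
      have "r x \<le> (\<Sum>ys\<in>?L. 1)" unfolding r_def by (intro sum_mono) simp
      then show ?thesis using cL by simp
    qed
    define X where "X = {x\<in>V. e / 2 * n ^ h \<le> r x}"
    have "e * n * n ^ h \<le> real (card R)" using dense by (simp add: n_def algebra_simps)
    also have "real (card R) = (\<Sum>xs | set xs \<subseteq> V \<and> length xs = Suc h. of_bool (xs \<in> R))"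
      using R V by (simp add: sum_of_bool_eq finite_lists_length_eq Int_absorb1 flip: Collect_conj_eq)
    also have "\<dots> = (\<Sum>x\<in>V. r x)" unfolding sum_lists_Suc r_def ..
    also have "\<dots> \<le> (\<Sum>x\<in>V. of_bool (x \<in> X) * n ^ h + e / 2 * n ^ h)"
      using r_le nh Suc.prems by (intro sum_mono) (auto simp: X_def add_increasing2)
    also have "\<dots> = real (card X) * n ^ h + n * (e / 2 * n ^ h)"
    proof -
      have "V \<inter> {x. x \<in> X} = X" by (auto simp: X_def)
      then show ?thesis using V by (simp add: sum.distrib n_def sum_of_bool_eq flip: sum_distrib_right)
    qed
    finally have "e * n * n ^ h \<le> (real (card X) + e * n / 2) * n ^ h" by (simp add: algebra_simps)
    then have "e * n \<le> real (card X) + e * n / 2" using nh by simp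
    then have "s \<le> card X" using ns by linarith
    then obtain S where S: "S \<subseteq> X" "card S = s" "finite S"
      by (meson obtain_subset_with_card_n)
    define N where "N ys = {x\<in>S. x # ys \<in> R}" for ys
    define Y where "Y = {ys\<in>?L. t \<le> card (N ys)}"
    have "real s * (e / 2 * n ^ h) = (\<Sum>x\<in>S. e / 2 * n ^ h)" using S by simp
    also have "\<dots> \<le> (\<Sum>x\<in>S. r x)" using S by (intro sum_mono) (auto simp: X_def)
    also have "\<dots> = (\<Sum>ys\<in>?L. \<Sum>x\<in>S. of_bool (x # ys \<in> R))" unfolding r_def by (rule sum.swap)
    also have "\<dots> = (\<Sum>ys\<in>?L. real (card (N ys)))"
      using S by (simp add: N_def sum_of_bool_eq Int_def)
    also have "\<dots> \<le> (\<Sum>ys\<in>?L. of_bool (ys \<in> Y) * real s + real t)"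
    proof (rule sum_mono)
      fix ys assume "ys \<in> ?L"
      moreover have "card (N ys) \<le> s"
        using S(3) unfolding S(2)[symmetric] by (intro card_mono) (auto simp: N_def)
      ultimately show "real (card (N ys)) \<le> of_bool (ys \<in> Y) * real s + real t"
        by (auto simp: Y_def)
    qed
    also have "\<dots> = real (card Y) * real s + n ^ h * real t"
    proof -
      have "?L \<inter> {ys. ys \<in> Y} = Y" by (auto simp: Y_def)
      then show ?thesis
        using L cL by (simp add: sum.distrib sum_of_bool_eq flip: sum_distrib_right)
    qed
    also have "n ^ h * real t \<le> real s * (e / 4 * n ^ h)"
    proof -
      have "real t \<le> real s * (e / 4)" using s by (simp add: algebra_simps)
      from mult_left_mono[OF this, of "n ^ h"] show ?thesis using nh by (simp add: algebra_simps)
    qed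
    finally have "real s * (e / 4 * n ^ h) \<le> real s * real (card Y)" by (simp add: algebra_simps)
    then have Y: "e / 4 * n ^ h \<le> real (card Y)" using s0 by simp
    have finY: "finite Y" by (rule finite_subset[OF _ L]) (auto simp: Y_def)
    \<comment> \<open>Pigeonhole over the possible sets \<open>N ys\<close>: the most frequent one
      becomes the first side of the box.\<close>
    have "\<exists>T\<in>Pow S. e' * n ^ h \<le> real (card {ys\<in>Y. N ys = T})"
    proof (rule ccontr)
      assume "\<not> ?thesis"
      then have less: "real (card {ys\<in>Y. N ys = T}) \<le> e' * n ^ h" if "T \<in> Pow S" for T
        using that by (meson linear)
      have "real (card Y) = (\<Sum>T\<in>Pow S. real (card {ys\<in>Y. N ys = T}))"
      proof -
        have "card Y = (\<Sum>T\<in>Pow S. card {ys\<in>Y. N ys = T})"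
        proof -
          have "N ` Y \<subseteq> Pow S" by (auto simp: N_def)
          from sum.group[OF finY _ this, of "\<lambda>_. 1::nat"] show ?thesis using S by simp
        qed
        then show ?thesis by simp
      qed
      also have "\<dots> \<le> (\<Sum>T\<in>Pow S. e' * n ^ h)" by (intro sum_mono less)
      also have "\<dots> = e / 8 * n ^ h" using S by (simp add: card_Pow e'_def)
      finally have "e / 4 * n ^ h \<le> e / 8 * n ^ h" using Y by linarith
      then show False using nh Suc.prems by simp
    qed
    then obtain T where T: "T \<in> Pow S" "e' * n ^ h \<le> real (card {ys\<in>Y. N ys = T})" ..
    let ?R = "{ys\<in>Y. N ys = T}"
    have "?R \<noteq> {}" using T nh \<open>0 < e'\<close> by (metis card.empty mult_pos_pos not_less of_nat_0)
    then have tT: "t \<le> card T" by (auto simp: Y_def)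
    obtain Ts where Ts: "length Ts = h" "\<forall>T\<in>set Ts. t \<le> card T" "listset Ts \<subseteq> ?R"
    proof -
      have "?R \<subseteq> ?L" by (auto simp: Y_def)
      from n0[OF V(1) n(1) this] show ?thesis using T(2) that by (auto simp: n_def)
    qed
    have "listset (T # Ts) \<subseteq> R"
      using Ts(3) by (auto simp: set_Cons_def N_def)
    then show "\<exists>Ts. length Ts = Suc h \<and> (\<forall>T\<in>set Ts. t \<le> card T) \<and> listset Ts \<subseteq> R"
      using Ts tT by (intro exI[of _ "T # Ts"]) auto
  qed
qed

section \<open>Sampling tuples of vertices\<close>

text \<open>The vertices are positions in the tuple, so that one walk pattern can be shared by many
  tuples. Equal entries become twin positions.\<close>

definition pullback :: "'a rel \<Rightarrow> 'a list \<Rightarrow> nat rel" where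
  "pullback E f = {(i, j). i < length f \<and> j < length f \<and> (f ! i, f ! j) \<in> E}"

lemma closed_walks_pullback:
  "w \<in> closed_walks (pullback E f) l \<longleftrightarrow>
    set w \<subseteq> {..<length f} \<and> map ((!) f) w \<in> closed_walks E l"
proof
  assume w: "w \<in> closed_walks (pullback E f) l"
  then show "set w \<subseteq> {..<length f} \<and> map ((!) f) w \<in> closed_walks E l"
    by (fastforce simp: closed_walks_def pullback_def in_set_conv_nth)
next
  assume "set w \<subseteq> {..<length f} \<and> map ((!) f) w \<in> closed_walks E l"
  then show "w \<in> closed_walks (pullback E f) l"
    by (cases "l = 0") (auto simp: closed_walks_def pullback_def subset_iff)
qed

text \<open>Otherwise one of the \<open>m ^ l\<close> patterns occurs on a dense set of tuples,
  hence on a box with sides of size at least \<open>l\<close>. Choosing a new vertex at every visit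
  to a side gives a closed \<open>l\<close>-walk without repetition.\<close>

lemma few_tuples_with_closed_walk:
  fixes e :: real
  assumes e: "0 < e" and m: "0 < m" and l: "0 < l"
  shows "\<exists>n0. \<forall>V E :: 'a rel. finite V \<longrightarrow> n0 \<le> card V \<longrightarrow> irrefl E \<longrightarrow>
    (\<forall>xs\<in>closed_walks E l. \<not> distinct xs) \<longrightarrow>
    real (card {f. set f \<subseteq> V \<and> length f = m \<and> closed_walks (pullback E f) l \<noteq> {}}) \<le> e * real (card V) ^ m"
proof -
  define e' where "e' = e / real m ^ l"
  have "0 < e'" using e m by (simp add: e'_def)
  from dense_tuples_contain_box[OF this, of m l] obtain n0 where
    "\<forall>V R :: 'a list set. finite V \<longrightarrow> n0 \<le> card V \<longrightarrow> R \<subseteq> {xs. set xs \<subseteq> V \<and> length xs = m} \<longrightarrow>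
      e' * real (card V) ^ m \<le> real (card R) \<longrightarrow>
      (\<exists>Ts. length Ts = m \<and> (\<forall>T\<in>set Ts. l \<le> card T) \<and> listset Ts \<subseteq> R)" ..
  note n0 = this[rule_format]
  show ?thesis
  proof (intro exI[of _ n0] allI impI, rule ccontr)
    fix V :: "'a set" and E :: "'a rel"
    assume V: "finite V" "n0 \<le> card V" and E: "irrefl E" "\<forall>xs\<in>closed_walks E l. \<not> distinct xs"
    let ?B = "{f. set f \<subseteq> V \<and> length f = m \<and> closed_walks (pullback E f) l \<noteq> {}}"
    let ?R = "\<lambda>w. {f. set f \<subseteq> V \<and> length f = m \<and> map ((!) f) w \<in> closed_walks E l}"
    let ?W = "{w. set w \<subseteq> {..<m} \<and> length w = l}"
    assume "\<not> real (card ?B) \<le> e * real (card V) ^ m"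
    then have B: "e * real (card V) ^ m < real (card ?B)" by simp
    have finL: "finite {f. set f \<subseteq> V \<and> length f = m}" using V by (simp add: finite_lists_length_eq)
    have finR: "finite (?R w)" for w by (rule finite_subset[OF _ finL]) auto
    have "\<exists>w\<in>?W. e' * real (card V) ^ m \<le> real (card (?R w))"
    proof (rule ccontr)
      assume "\<not> ?thesis"
      then have less: "real (card (?R w)) \<le> e' * real (card V) ^ m" if "w \<in> ?W" for w
        using that by (meson linear)
      have W: "finite ?W" "card ?W = m ^ l"
        by (simp_all add: finite_lists_length_eq card_lists_length_eq)
      have "?B \<subseteq> (\<Union>w\<in>?W. ?R w)"
      proof
        fix f assume f: "f \<in> ?B"
        then obtain w where "w \<in> closed_walks (pullback E f) l" by blast
        then have "w \<in> ?W" "f \<in> ?R w"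
          using f unfolding closed_walks_pullback by (auto simp only: closed_walks_def mem_Collect_eq length_map)
        then show "f \<in> (\<Union>w\<in>?W. ?R w)" by blast
      qed
      then have "card ?B \<le> card (\<Union>w\<in>?W. ?R w)"
        using W finR by (intro card_mono) auto
      also have "\<dots> \<le> (\<Sum>w\<in>?W. card (?R w))" using W by (intro card_UN_le)
      finally have "real (card ?B) \<le> (\<Sum>w\<in>?W. real (card (?R w)))" by (simp flip: of_nat_sum)
      also have "\<dots> \<le> (\<Sum>w\<in>?W. e' * real (card V) ^ m)" by (intro sum_mono less)
      also have "\<dots> = e * real (card V) ^ m" using W m by (simp add: e'_def)
      finally show False using B by simp
    qed
    then obtain w where w: "w \<in> ?W" "e' * real (card V) ^ m \<le> real (card (?R w))" ..
    obtain Ts where Ts: "length Ts = m" "\<forall>T\<in>set Ts. l \<le> card T" "listset Ts \<subseteq> ?R w"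
      using n0[OF V, of "?R w"] w by blast
    have wm: "w ! s < m" if "s < l" for s
      using w that by (auto simp: subset_iff)
    \<comment> \<open>The pattern may visit a position several times; each visit receives its own
      vertex.\<close>
    obtain ys where ys: "length ys = l" "distinct ys" "\<forall>s<l. ys ! s \<in> Ts ! (w ! s)"
      using distinct_representatives[of l "\<lambda>s. Ts ! (w ! s)"] Ts wm by (metis nth_mem)
    have "\<forall>i<m. \<exists>x. x \<in> Ts ! i"
    proof (intro allI impI)
      fix i assume "i < m"
      then have "0 < card (Ts ! i)" using Ts l by (metis nth_mem less_le_trans)
      then show "\<exists>x. x \<in> Ts ! i" by (metis card.empty ex_in_conv less_irrefl)
    qed
    then obtain g where g: "\<forall>i<m. g i \<in> Ts ! i" by metis
    define f0 where "f0 = map g [0..<m]"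
    have f0: "f0 \<in> listset Ts" using g Ts by (auto simp: f0_def listset_iff_nth)
    have "(ys ! s, ys ! (Suc s mod l)) \<in> E" if "s < l" for s
    proof -
      let ?i = "w ! s" and ?j = "w ! (Suc s mod l)"
      have s': "Suc s mod l < l" using l by simp
      have arc: "(f ! ?i, f ! ?j) \<in> E" if "f \<in> listset Ts" for f
      proof -
        have "map ((!) f) w \<in> closed_walks E l" using that Ts by blast
        from closed_walks_nth[OF this \<open>s < l\<close>] show ?thesis using \<open>s < l\<close> s' w by simp
      qed
      \<comment> \<open>Consecutive pattern positions differ since there are no loops, so both
        coordinates of a box tuple can be reset independently.\<close>
      have ij: "?i \<noteq> ?j" using arc[OF f0] E(1) by (auto simp: irrefl_def)
      have "f0[?i := ys ! s, ?j := ys ! (Suc s mod l)] \<in> listset Ts"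
        using f0 ys(3)[rule_format, OF \<open>s < l\<close>] ys(3)[rule_format, OF s'] Ts(1) wm[OF \<open>s < l\<close>] wm[OF s']
        by (auto simp: listset_iff_nth nth_list_update)
      from arc[OF this] show ?thesis
        using ij wm[OF \<open>s < l\<close>] wm[OF s'] Ts(1) f0 by (simp add: listset_iff_nth nth_list_update)
    qed
    then have "ys \<in> closed_walks E l" using ys by (auto simp: closed_walks_def)
    then show False using ys E by blast
  qed
qed

text \<open>Permuting coordinates moves the positions \<open>c\<close> to the front; then a closed
  walk can be prescribed there and the other \<open>m - k\<close> entries are free.\<close>

lemma card_tuples_with_walk_at:
  assumes V: "finite V" "E \<subseteq> V \<times> V" and c: "distinct c" "set c \<subseteq> {..<m}" "length c = k"
  shows "card (closed_walks E k) * card V ^ (m - k)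
    \<le> card {f. set f \<subseteq> V \<and> length f = m \<and> map ((!) f) c \<in> closed_walks E k}"
proof -
  \<comment> \<open>The permutation \<open>c'\<close> lists \<open>c\<close> first. Reindexing by it
    is injective on a finite set of tuples, hence surjective.\<close>
  have km: "k \<le> m"
    using c by (metis card_lessThan card_mono distinct_card finite_lessThan)
  define c' where "c' = c @ filter (\<lambda>i. i \<notin> set c) [0..<m]"
  have c': "distinct c'" "set c' = {..<m}" using c by (auto simp: c'_def)
  then have lc': "length c' = m" using distinct_card by fastforce
  let ?L = "{f. set f \<subseteq> V \<and> length f = m}"
  have L: "finite ?L" using V by (simp add: finite_lists_length_eq)
  define p where "p f = map ((!) f) c'" for f :: "'a list"
  have "p ` ?L \<subseteq> ?L" using c' lc' by (fastforce simp: p_def)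
  moreover have "inj_on p ?L"
  proof (rule inj_onI)
    fix f g assume fg: "f \<in> ?L" "g \<in> ?L" "p f = p g"
    then have "\<forall>i\<in>set c'. f ! i = g ! i" unfolding p_def by (metis map_eq_conv)
    then show "f = g" using fg c' by (intro nth_equalityI) auto
  qed
  ultimately have p: "p ` ?L = ?L" using L by (intro endo_inj_surj)
  let ?F = "{f. set f \<subseteq> V \<and> length f = m \<and> map ((!) f) c \<in> closed_walks E k}"
  let ?G = "{f\<in>?L. take k f \<in> closed_walks E k}"
  have tp: "take k (p f) = map ((!) f) c" for f
    using c by (simp add: p_def c'_def take_map)
  have "?G \<subseteq> p ` ?F"
  proof
    fix g assume g: "g \<in> ?G"
    then obtain f where "f \<in> ?L" "g = p f" using p by blast
    then show "g \<in> p ` ?F" using g tp[of f] by auto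
  qed
  moreover have "finite ?F" by (rule finite_subset[OF _ L]) auto
  ultimately have GF: "card ?G \<le> card ?F" by (rule surj_card_le[rotated])
  let ?M = "{g. set g \<subseteq> V \<and> length g = m - k}"
  have "card (closed_walks E k \<times> ?M) \<le> card ?G"
  proof (rule card_inj_on_le[where f = "\<lambda>(v, g). v @ g"])
    show "inj_on (\<lambda>(v, g). v @ g) (closed_walks E k \<times> ?M)"
      by (auto simp: inj_on_def closed_walks_def)
    show "(\<lambda>(v, g). v @ g) ` (closed_walks E k \<times> ?M) \<subseteq> ?G"
    proof (rule image_subsetI)
      fix x assume "x \<in> closed_walks E k \<times> ?M"
      then obtain v g where x: "x = (v, g)" "v \<in> closed_walks E k" "set g \<subseteq> V" "length g = m - k" by auto
      then have "set v \<subseteq> V" "length v = k" using closed_walks_subset_lists[OF V(2), of k] by auto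
      then show "(case x of (v, g) \<Rightarrow> v @ g) \<in> ?G" using x km by auto
    qed
    show "finite ?G" by (rule finite_subset[OF _ L]) auto
  qed
  then show ?thesis
    using GF V by (simp add: card_cartesian_product card_lists_length_eq)
qed

text \<open>The count is a falling factorial, each of whose \<open>k\<close> factors exceeds
  \<open>m - k\<close>.\<close>

lemma card_distinct_lists_ge:
  assumes "k \<le> m"
  shows "(m - k) ^ k \<le> card {c. length c = k \<and> distinct c \<and> set c \<subseteq> {..<m}}"
proof -
  have "(m - k) ^ k = (\<Prod>i\<in>{m - k + 1..m}. m - k)" using assms by simp
  also have "\<dots> \<le> \<Prod>{m - k + 1..m}" by (intro prod_mono) auto
  finally show ?thesis using assms by (subst card_lists_distinct_length_eq) auto
qed

text \<open>
  Averages the number of closed \<open>k\<close>-walks over the digraphs induced by all \<open>m\<close>-tuples of vertices: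
  those tuples without closed \<open>l\<close>-walk obey the exact bound, and the others are few.
\<close>

lemma closed_walks_asymptotic_bound:
  fixes e :: real
  assumes e: "0 < e"
    and l: "2 * (k - 1)\<^sup>2 \<le> l" and ndvd: "\<not> k dvd l" and "0 < k" "0 < d"
    and d: "\<And>g. g dvd k \<Longrightarrow> \<not> g dvd l \<Longrightarrow> d \<le> g"
  shows "\<exists>n0. \<forall>V E :: 'a rel. finite V \<longrightarrow> n0 \<le> card V \<longrightarrow> E \<subseteq> V \<times> V \<longrightarrow> irrefl E \<longrightarrow>
    (\<forall>xs\<in>closed_walks E l. \<not> distinct xs) \<longrightarrow>
    real (card (closed_walks E k)) \<le> (1 / real d ^ (k - 1) + e) * real (card V) ^ k"
proof -
  have "0 < l" using ndvd by (intro Nat.gr0I) auto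
  define a where "a = 1 / real d ^ (k - 1)"
  have a: "0 < a" "a \<le> 1" using \<open>0 < d\<close> by (auto simp: a_def divide_le_eq one_le_power)
  \<comment> \<open>Two errors are absorbed: the factor \<open>1 + e1\<close> for repeated positions
    and the summand \<open>e1\<close> for bad tuples. Since \<open>a\<close> and \<open>e1\<close>
    are at most 1, their total is at most \<open>3 * e1\<close>.\<close>
  define e1 where "e1 = min e 1 / 3"
  have e1: "0 < e1" using e by (simp add: e1_def)
  have "e1 * a \<le> e1 * 1" "e1 * e1 \<le> e1 * 1"
    by (rule mult_left_mono; use e1 a e in \<open>simp add: e1_def\<close>)+
  moreover have "(1 + e1) * (a + e1) = a + e1 + e1 * a + e1 * e1" by (simp add: algebra_simps)
  ultimately have "(1 + e1) * (a + e1) \<le> a + 3 * e1" by linarith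
  also have "\<dots> \<le> a + e" by (simp add: e1_def)
  finally have ae: "(1 + e1) * (a + e1) \<le> a + e" .
  have "(\<lambda>m::nat. real m / (real m - real k)) \<longlonglongrightarrow> 1" by real_asymp
  then have "(\<lambda>m::nat. (real m / (real m - real k)) ^ k) \<longlonglongrightarrow> 1 ^ k" by (rule tendsto_power)
  then have "\<forall>\<^sub>F m in sequentially. (real m / (real m - real k)) ^ k < 1 + e1"
    using e1 by (intro order_tendstoD(2)) auto
  then have "\<forall>\<^sub>F m in sequentially. (real m / (real m - real k)) ^ k < 1 + e1 \<and> k < m"
    using eventually_gt_at_top[of k] by (rule eventually_conj)
  then obtain m where m: "(real m / (real m - real k)) ^ k < 1 + e1" "k < m"
    using eventually_happens'[OF sequentially_bot] by blast
  define q where "q = real (m - k) ^ k"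
  have q: "0 < q" using m by (simp add: q_def)
  have mq: "real m ^ k \<le> (1 + e1) * q"
    using m q by (simp add: q_def of_nat_diff power_divide divide_less_eq)
  from few_tuples_with_closed_walk[OF e1 _ \<open>0 < l\<close>, of m] m obtain n0 where
    "\<forall>V E :: 'a rel. finite V \<longrightarrow> n0 \<le> card V \<longrightarrow> irrefl E \<longrightarrow>
      (\<forall>xs\<in>closed_walks E l. \<not> distinct xs) \<longrightarrow>
      real (card {f. set f \<subseteq> V \<and> length f = m \<and> closed_walks (pullback E f) l \<noteq> {}}) \<le> e1 * real (card V) ^ m"
    by auto
  note n0 = this[rule_format]
  show ?thesis
  proof (intro exI[of _ "max 1 n0"] allI impI)
    fix V :: "'a set" and E :: "'a rel"
    assume V: "finite V" "max 1 n0 \<le> card V" and E: "E \<subseteq> V \<times> V" "irrefl E"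
      and no: "\<forall>xs\<in>closed_walks E l. \<not> distinct xs"
    define n where "n = real (card V)"
    have n: "0 < n" using V by (simp add: n_def)
    define N where "N = real (card (closed_walks E k))"
    let ?L = "{f. set f \<subseteq> V \<and> length f = m}"
    let ?B = "{f. set f \<subseteq> V \<and> length f = m \<and> closed_walks (pullback E f) l \<noteq> {}}"
    let ?C = "{c. length c = k \<and> distinct c \<and> set c \<subseteq> {..<m}}"
    have L: "finite ?L" "real (card ?L) = n ^ m"
      using V by (simp_all add: finite_lists_length_eq card_lists_length_eq n_def)
    have C: "finite ?C"
      by (rule finite_subset[OF _ finite_lists_length_eq[of "{..<m}" k]]) auto
    have sub: "pullback E f \<subseteq> {..<m} \<times> {..<m}" if "f \<in> ?L" for f
      using that by (auto simp: pullback_def)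
    have B: "real (card ?B) \<le> e1 * n ^ m"
      unfolding n_def using n0[of V E] V E no by (auto simp: max_def split: if_splits)
    \<comment> \<open>Double counting of pairs of an \<open>m\<close>-tuple \<open>f\<close> and a
      list \<open>c\<close> of distinct positions at which \<open>f\<close> spells a closed
      \<open>k\<close>-walk.\<close>
    have "q * (N * n ^ (m - k)) \<le> real (card ?C) * (N * n ^ (m - k))"
    proof (rule mult_right_mono)
      have "real ((m - k) ^ k) \<le> real (card ?C)"
        using card_distinct_lists_ge[of k m] m by (intro of_nat_mono) simp
      then show "q \<le> real (card ?C)" by (simp only: q_def of_nat_power)
    qed (simp add: N_def n_def)
    also have "\<dots> = (\<Sum>c\<in>?C. N * n ^ (m - k))" by simp
    also have "\<dots> \<le> (\<Sum>c\<in>?C. real (card {f\<in>?L. map ((!) f) c \<in> closed_walks E k}))"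
    proof (rule sum_mono)
      fix c assume "c \<in> ?C"
      then have "card (closed_walks E k) * card V ^ (m - k)
          \<le> card {f. set f \<subseteq> V \<and> length f = m \<and> map ((!) f) c \<in> closed_walks E k}"
        using V E by (intro card_tuples_with_walk_at) auto
      then show "N * n ^ (m - k) \<le> real (card {f\<in>?L. map ((!) f) c \<in> closed_walks E k})"
        unfolding N_def n_def by (simp add: conj_assoc flip: of_nat_power of_nat_mult)
    qed
    also have "\<dots> = (\<Sum>c\<in>?C. \<Sum>f\<in>?L. of_bool (map ((!) f) c \<in> closed_walks E k))"
      using L by (simp add: sum_of_bool_eq Int_def)
    also have "\<dots> = (\<Sum>f\<in>?L. \<Sum>c\<in>?C. of_bool (map ((!) f) c \<in> closed_walks E k))"
      by (rule sum.swap)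
    also have "\<dots> = (\<Sum>f\<in>?L. real (card {c\<in>?C. map ((!) f) c \<in> closed_walks E k}))"
      using C by (simp add: sum_of_bool_eq Int_def)
    also have "\<dots> \<le> (\<Sum>f\<in>?L. real (card (closed_walks (pullback E f) k)))"
    proof (intro sum_mono of_nat_mono card_mono)
      fix f assume f: "f \<in> ?L"
      show "finite (closed_walks (pullback E f) k)"
        by (rule finite_closed_walks[OF _ sub[OF f]]) simp
      show "{c\<in>?C. map ((!) f) c \<in> closed_walks E k} \<subseteq> closed_walks (pullback E f) k"
        using f by (auto simp: closed_walks_pullback)
    qed
    \<comment> \<open>Tuples without closed \<open>l\<close>-walk obey the exact bound on
      \<open>m\<close> vertices; the others get the trivial bound \<open>m ^ k\<close>.\<close>
    also have "\<dots> \<le> (\<Sum>f\<in>?L. real m ^ k * a + of_bool (closed_walks (pullback E f) l \<noteq> {}) * real m ^ k)"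
    proof (rule sum_mono)
      fix f assume f: "f \<in> ?L"
      show "real (card (closed_walks (pullback E f) k)) \<le> real m ^ k * a + of_bool (closed_walks (pullback E f) l \<noteq> {}) * real m ^ k"
      proof (cases "closed_walks (pullback E f) l \<noteq> {}")
        case True
        have "card (closed_walks (pullback E f) k) \<le> card {w. set w \<subseteq> {..<m} \<and> length w = k}"
          using closed_walks_subset_lists[OF sub[OF f]] by (intro card_mono finite_lists_length_eq) auto
        also have "\<dots> = m ^ k" by (simp add: card_lists_length_eq)
        finally have "real (card (closed_walks (pullback E f) k)) \<le> real m ^ k"
          by (metis of_nat_le_iff of_nat_power)
        then show ?thesis using True a by (simp add: add_increasing)
      next
        case False
        then have "\<nexists>u. (u, u) \<in> pullback E f ^^ l"
          using closed_walks_nonempty_iff[OF \<open>0 < l\<close>, of "pullback E f"] by blast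
        then have "real (card (closed_walks (pullback E f) k))
            \<le> real (card {..<m}) * (real (card {..<m}) / real d) ^ (k - 1)"
          using l ndvd d \<open>0 < k\<close> \<open>0 < d\<close> by (intro card_closed_walks_le[OF _ sub[OF f]]) auto
        also have "\<dots> = real m ^ k * a"
          using \<open>0 < k\<close> by (simp add: a_def power_divide flip: power_Suc)
        finally show ?thesis using False by auto
      qed
    qed
    also have "\<dots> = n ^ m * (real m ^ k * a) + real (card ?B) * real m ^ k"
    proof -
      have "(\<Sum>f\<in>?L. of_bool (closed_walks (pullback E f) l \<noteq> {})) = real (card ?B)"
        using L(1) by (simp add: Int_def conj_assoc)
      then show ?thesis
        unfolding sum.distrib sum_distrib_right[symmetric] using L by simp
    qed
    also have "\<dots> \<le> n ^ m * (real m ^ k * a) + (e1 * n ^ m) * real m ^ k"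
      using B by (intro add_left_mono mult_right_mono) auto
    also have "\<dots> = real m ^ k * ((a + e1) * n ^ m)" by (simp add: algebra_simps)
    also have "\<dots> \<le> ((1 + e1) * q) * ((a + e1) * n ^ m)"
      using mq a e1 n by (intro mult_right_mono) auto
    also have "\<dots> = q * (((1 + e1) * (a + e1)) * n ^ m)" by (simp add: algebra_simps)
    also have "\<dots> \<le> q * ((a + e) * n ^ m)"
      using ae q n by (intro mult_left_mono mult_right_mono) auto
    also have "n ^ m = n ^ k * n ^ (m - k)" using m by (simp flip: power_add)
    finally have "N * n ^ (m - k) \<le> ((a + e) * n ^ k) * n ^ (m - k)" using q by (simp add: mult.assoc)
    then show "real (card (closed_walks E k)) \<le> (1 / real d ^ (k - 1) + e) * real (card V) ^ k"
      using n by (simp add: N_def n_def a_def)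
  qed
qed

section \<open>Copies of directed cycles as classes of closed walks\<close>

definition walk_digraph :: "'a list \<Rightarrow> 'a pair_pre_digraph" where
  "walk_digraph xs = \<lparr> pverts = set xs, parcs = (\<lambda>i. (xs ! i, xs ! (Suc i mod length xs))) ` {..<length xs} \<rparr>"

lemma walk_digraph_in_copies:
  assumes G: "pair_wf_digraph G" and xs: "xs \<in> closed_walks (parcs G) k" "distinct xs"
  shows "walk_digraph xs \<in> copies (dicycle k) G"
proof -
  interpret pair_wf_digraph G by (fact G)
  let ?K = "walk_digraph xs"
  have len: "length xs = k" and arc: "\<And>i. i < k \<Longrightarrow> (xs ! i, xs ! (Suc i mod k)) \<in> parcs G"
    using xs by (auto simp: closed_walks_def)
  have K: "pverts ?K = set xs" "parcs ?K = (\<lambda>i. (xs ! i, xs ! (Suc i mod k))) ` {..<k}"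
    by (simp_all add: walk_digraph_def len)
  have suc: "Suc i mod k < k" if "i < k" for i using that by auto
  have sub: "parcs ?K \<subseteq> pverts ?K \<times> pverts ?K" using suc by (auto simp: K len)
  have wfK: "wf_digraph (with_proj ?K)"
    using sub by unfold_locales auto
  have "pverts ?K \<subseteq> pverts G"
    unfolding K using in_arcsD1[OF arc] by (auto simp: in_set_conv_nth len)
  moreover have "parcs ?K \<subseteq> parcs G" using arc by (auto simp: K)
  moreover have "wf_digraph (with_proj G)" by unfold_locales
  ultimately have 1: "subgraph (with_proj ?K) (with_proj G)"
    using wfK by (simp add: subgraph_def compatible_def)
  \<comment> \<open>The isomorphism sends each vertex to its position in \<open>xs\<close>.\<close>
  define p where "p = the_inv_into {..<k} ((!) xs)"
  have inj: "inj_on ((!) xs) {..<k}" using xs(2) len by (simp add: inj_on_nth)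
  have p: "p (xs ! i) = i" if "i < k" for i
    using inj that by (simp add: p_def the_inv_into_f_f)
  have injp: "inj_on p (set xs)"
    using p by (auto simp: inj_on_def in_set_conv_nth len)
  let ?f = "\<lparr> iso_verts = p, iso_arcs = map_prod p p, iso_head = snd, iso_tail = fst \<rparr>"
  have "inj_on (map_prod p p) (parcs ?K)"
    using map_prod_inj_on[OF injp injp] sub unfolding K(1) by (rule inj_on_subset)
  then have "pre_digraph.digraph_isomorphism (with_proj ?K) ?f"
    using wfK injp by (simp add: pre_digraph.digraph_isomorphism_def K(1))
  moreover have "with_proj (dicycle k) = app_iso ?f (with_proj ?K)"
  proof -
    have "p ` set xs = {..<k}"
      unfolding set_conv_nth len using p by force
    moreover have "map_prod p p ` parcs ?K = {(i, Suc i mod k) |i. i < k}"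
      unfolding K image_image using p suc by force
    ultimately show ?thesis by (simp add: app_iso_def with_proj_def dicycle_def K(1))
  qed
  ultimately have "digraph_iso (with_proj ?K) (with_proj (dicycle k))"
    unfolding digraph_iso_def by blast
  with 1 show ?thesis by (simp add: copies_def)
qed

text \<open>Conversely to the previous lemma, the inverse of an isomorphism onto the standard cycle
  lists the vertices of a copy in cyclic order.\<close>

lemma copies_dicycle_eq_walk_digraphs:
  assumes G: "pair_wf_digraph G"
  shows "copies (dicycle k) G = walk_digraph ` {xs \<in> closed_walks (parcs G) k. distinct xs}"
proof
  show "walk_digraph ` {xs \<in> closed_walks (parcs G) k. distinct xs} \<subseteq> copies (dicycle k) G"
    using walk_digraph_in_copies[OF G] by auto
  show "copies (dicycle k) G \<subseteq> walk_digraph ` {xs \<in> closed_walks (parcs G) k. distinct xs}"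
  proof
    fix K assume "K \<in> copies (dicycle k) G"
    then obtain f where sub: "subgraph (with_proj K) (with_proj G)"
      and f: "pre_digraph.digraph_isomorphism (with_proj K) f"
        "with_proj (dicycle k) = app_iso f (with_proj K)"
      by (auto simp: copies_def digraph_iso_def)
    let ?h = "iso_verts f"
    have wfK: "wf_digraph (with_proj K)" using sub by (simp add: subgraph_def)
    have hV: "?h ` pverts K = {..<k}" and hA: "iso_arcs f ` parcs K = {(i, Suc i mod k) |i. i < k}"
      and ht: "iso_tail f = fst" "iso_head f = snd"
      using f(2) by (auto simp: app_iso_def with_proj_def dicycle_def)
    have inj: "inj_on ?h (pverts K)"
      and arcs: "\<And>a. a \<in> parcs K \<Longrightarrow> ?h (fst a) = fst (iso_arcs f a) \<and> ?h (snd a) = snd (iso_arcs f a)"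
      using f(1) ht by (auto simp: pre_digraph.digraph_isomorphism_def)
    have arc_verts: "fst a \<in> pverts K" "snd a \<in> pverts K" if "a \<in> parcs K" for a
      using that wf_digraph.tail_in_verts[OF wfK] wf_digraph.head_in_verts[OF wfK] by auto
    define g where "g = the_inv_into (pverts K) ?h"
    have gh: "g (?h v) = v" if "v \<in> pverts K" for v
      using inj that by (simp add: g_def the_inv_into_f_f)
    have a_eq: "a = (g (fst (iso_arcs f a)), g (snd (iso_arcs f a)))" if "a \<in> parcs K" for a
      using arcs[OF that] gh arc_verts[OF that] by (metis prod.collapse)
    define xs where "xs = map g [0..<k]"
    have gV: "g ` {..<k} = pverts K"
      unfolding hV[symmetric] image_image using gh by simp
    have "inj_on g {..<k}" unfolding hV[symmetric] by (rule inj_on_inverseI[of _ ?h]) (auto simp: gh)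
    then have dist: "distinct xs" by (simp add: xs_def distinct_map atLeast0LessThan)
    have "parcs K = (\<lambda>a. (g (fst a), g (snd a))) ` iso_arcs f ` parcs K"
      unfolding image_image using a_eq by force
    also have "\<dots> = (\<lambda>i. (g i, g (Suc i mod k))) ` {..<k}"
      unfolding hA by force
    also have "\<dots> = (\<lambda>i. (xs ! i, xs ! (Suc i mod k))) ` {..<k}"
      by (intro image_cong) (auto simp: xs_def)
    finally have pK: "parcs K = (\<lambda>i. (xs ! i, xs ! (Suc i mod k))) ` {..<k}" .
    have "K = walk_digraph xs"
      using pK gV by (simp add: walk_digraph_def xs_def atLeast0LessThan)
    moreover have "parcs K \<subseteq> parcs G" using sub by (simp add: subgraph_def)
    then have "xs \<in> closed_walks (parcs G) k" by (auto simp: closed_walks_def pK xs_def)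
    ultimately show "K \<in> walk_digraph ` {xs \<in> closed_walks (parcs G) k. distinct xs}"
      using dist by blast
  qed
qed

lemma walk_digraph_rotate1: "walk_digraph (rotate1 xs) = walk_digraph xs"
proof (cases "xs = []")
  case False
  let ?k = "length xs"
  have k: "0 < ?k" using False by simp
  have "(\<lambda>i. (rotate1 xs ! i, rotate1 xs ! (Suc i mod ?k))) ` {..<?k}
    = (\<lambda>i. (xs ! i, xs ! (Suc i mod ?k))) ` (\<lambda>i. Suc i mod ?k) ` {..<?k}"
    unfolding image_image using k by (intro image_cong) (auto simp: nth_rotate1)
  also have "(\<lambda>i. Suc i mod ?k) ` {..<?k} = {..<?k}"
  proof
    show "{..<?k} \<subseteq> (\<lambda>i. Suc i mod ?k) ` {..<?k}"
    proof
      fix j assume "j \<in> {..<?k}"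
      then have "j = Suc (if j = 0 then ?k - 1 else j - 1) mod ?k"
        "(if j = 0 then ?k - 1 else j - 1) \<in> {..<?k}" using k by auto
      then show "j \<in> (\<lambda>i. Suc i mod ?k) ` {..<?k}" by (rule image_eqI)
    qed
  qed (use k in auto)
  finally show ?thesis by (simp add: walk_digraph_def)
qed simp

lemma walk_digraph_rotate: "walk_digraph (rotate n xs) = walk_digraph xs"
  by (induction n) (simp_all add: walk_digraph_rotate1)

text \<open>On a cycle every vertex has one successor, so a list in the fibre is determined by its
  first entry; rotations realise all \<open>k\<close> of these.\<close>

lemma card_walk_digraph_fibre:
  assumes xs: "xs \<in> closed_walks E k" "distinct xs" and "0 < k"
  shows "card {ys \<in> closed_walks E k. distinct ys \<and> walk_digraph ys = walk_digraph xs} = k"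
proof -
  let ?F = "{ys \<in> closed_walks E k. distinct ys \<and> walk_digraph ys = walk_digraph xs}"
  have "bij_betw (\<lambda>ys. ys ! 0) ?F (set xs)"
  proof (rule bij_betwI')
    fix ys zs assume yz: "ys \<in> ?F" "zs \<in> ?F"
    then have len: "length ys = k" "length zs = k" and dist: "distinct zs"
      by (auto simp: closed_walks_def)
    have "parcs (walk_digraph ys) = parcs (walk_digraph zs)" using yz by simp
    then have arcs: "(\<lambda>i. (ys ! i, ys ! (Suc i mod k))) ` {..<k} = (\<lambda>i. (zs ! i, zs ! (Suc i mod k))) ` {..<k}"
      by (simp add: walk_digraph_def len)
    show "ys ! 0 = zs ! 0 \<longleftrightarrow> ys = zs"
    proof
      assume 0: "ys ! 0 = zs ! 0"
      have "ys ! i = zs ! i" if "i < k" for i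
        using that
      proof (induction i)
        case (Suc i)
        have "(ys ! i, ys ! (Suc i mod k)) \<in> (\<lambda>i. (zs ! i, zs ! (Suc i mod k))) ` {..<k}"
          unfolding arcs[symmetric] using Suc.prems by (intro imageI) simp
        then obtain j where j: "j < k" "ys ! i = zs ! j" "ys ! Suc i = zs ! (Suc j mod k)"
          using Suc.prems by auto
        then have "zs ! i = zs ! j" using Suc by simp
        then have "i = j" using dist j(1) Suc.prems len by (simp add: nth_eq_iff_index_eq)
        then show ?case using j Suc.prems by simp
      qed (use 0 in simp)
      then show "ys = zs" using len by (intro nth_equalityI) auto
    qed simp
  next
    fix ys assume ys: "ys \<in> ?F"
    then have "length ys = k" by (simp add: closed_walks_def)
    moreover have "set ys = set xs" using ys by (simp add: walk_digraph_def)
    ultimately show "ys ! 0 \<in> set xs" using \<open>0 < k\<close> nth_mem by metis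
  next
    fix x assume "x \<in> set xs"
    then obtain n where n: "n < k" "x = xs ! n" using xs by (auto simp: in_set_conv_nth closed_walks_def)
    have "rotate n xs \<in> closed_walks E k"
      using bij_betw_rotate1_closed_walks[of E k] xs(1)
      by (induction n) (auto simp: bij_betw_def)
    then have "rotate n xs \<in> ?F" using xs(2) by (simp add: walk_digraph_rotate)
    moreover have "rotate n xs ! 0 = x"
      using n xs(1) \<open>0 < k\<close> by (simp add: nth_rotate closed_walks_def)
    ultimately show "\<exists>ys\<in>?F. x = ys ! 0" by blast
  qed
  then have "card ?F = card (set xs)" by (rule bij_betw_same_card)
  also have "\<dots> = k" using xs by (simp add: distinct_card closed_walks_def)
  finally show ?thesis .
qed

lemma card_copies_dicycle:
  assumes "pair_digraph G" "0 < k"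
  shows "k * card (copies (dicycle k) G) = card {xs \<in> closed_walks (parcs G) k. distinct xs}"
proof -
  interpret pair_digraph G by (fact assms)
  let ?A = "{xs \<in> closed_walks (parcs G) k. distinct xs}"
  have "parcs G \<subseteq> pverts G \<times> pverts G" by (auto dest: in_arcsD1 in_arcsD2)
  then have fin: "finite ?A" using finite_closed_walks[OF pair_finite_verts] by simp
  have "card ?A = (\<Sum>K\<in>walk_digraph ` ?A. card {xs \<in> ?A. walk_digraph xs = K})"
    using sum.group[OF fin finite_imageI[OF fin, of walk_digraph] subset_refl, of "\<lambda>_. 1::nat"] by simp
  also have "\<dots> = (\<Sum>K\<in>walk_digraph ` ?A. k)"
    using card_walk_digraph_fibre[OF _ _ \<open>0 < k\<close>, of _ "parcs G"] by (intro sum.cong) (auto simp: conj_assoc)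
  also have "\<dots> = k * card (copies (dicycle k) G)"
    by (simp add: copies_dicycle_eq_walk_digraphs[OF pair_wf_digraph_axioms])
  finally show ?thesis by simp
qed

lemma copies_dicycle_empty_iff:
  assumes "pair_wf_digraph G"
  shows "copies (dicycle l) G = {} \<longleftrightarrow> (\<forall>xs\<in>closed_walks (parcs G) l. \<not> distinct xs)"
  by (auto simp: copies_dicycle_eq_walk_digraphs[OF assms])

section \<open>The blow-up of a directed cycle\<close>

text \<open>Extend lists one entry at a time; at most \<open>k\<close> elements are already taken,
  so at least \<open>q - k\<close> choices remain.\<close>

lemma card_distinct_transversals_ge:
  assumes A: "\<And>i. finite (A i)" "\<And>i. q \<le> card (A i)" and "j \<le> k"
  shows "(q - k) ^ j \<le> card {xs. length xs = j \<and> distinct xs \<and> (\<forall>i<j. xs ! i \<in> A i)}"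
  using \<open>j \<le> k\<close>
proof (induction j)
  case 0
  have "{xs. length xs = 0 \<and> distinct xs \<and> (\<forall>i<0. xs ! i \<in> A i)} = {[]}" by auto
  then show ?case by simp
next
  case (Suc j)
  let ?P = "\<lambda>j. {xs. length xs = j \<and> distinct xs \<and> (\<forall>i<j. xs ! i \<in> A i)}"
  have fin: "finite (?P j)" for j
  proof (rule finite_subset)
    show "?P j \<subseteq> {xs. set xs \<subseteq> (\<Union>i<j. A i) \<and> length xs = j}"
      by (fastforce simp: in_set_conv_nth)
  qed (use A in \<open>simp add: finite_lists_length_eq\<close>)
  have "(q - k) ^ Suc j \<le> card (?P j) * (q - k)" using Suc by (simp add: mult.commute)
  also have "\<dots> = (\<Sum>xs\<in>?P j. q - k)" by simp
  also have "\<dots> \<le> (\<Sum>xs\<in>?P j. card (A j - set xs))"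
  proof (rule sum_mono)
    fix xs assume "xs \<in> ?P j"
    then have "card (set xs) \<le> k" using Suc.prems card_length[of xs] by simp
    moreover have "card (A j) - card (set xs) \<le> card (A j - set xs)" by (rule diff_card_le_card_Diff) simp
    ultimately show "q - k \<le> card (A j - set xs)" using A(2)[of j] by simp
  qed
  also have "\<dots> = card (Sigma (?P j) (\<lambda>xs. A j - set xs))"
    using fin A by (subst card_SigmaI) auto
  also have "\<dots> \<le> card (?P (Suc j))"
  proof (rule card_inj_on_le[where f = "\<lambda>(xs, x). xs @ [x]"])
    show "inj_on (\<lambda>(xs, x). xs @ [x]) (Sigma (?P j) (\<lambda>xs. A j - set xs))"
      by (auto simp: inj_on_def)
    show "(\<lambda>(xs, x). xs @ [x]) ` Sigma (?P j) (\<lambda>xs. A j - set xs) \<subseteq> ?P (Suc j)"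
      by (auto simp: nth_append less_Suc_eq)
  qed (rule fin)
  finally show ?case .
qed

text \<open>The parts are the residue classes modulo \<open>d\<close>, which are balanced for every
  \<open>n\<close>.\<close>

definition cycle_blowup :: "nat \<Rightarrow> nat \<Rightarrow> nat pair_pre_digraph" where
  "cycle_blowup d n = \<lparr> pverts = {..<n}, parcs = {(i, j). i < n \<and> j < n \<and> j mod d = Suc i mod d} \<rparr>"

lemma pair_digraph_cycle_blowup:
  assumes "2 \<le> d"
  shows "pair_digraph (cycle_blowup d n)"
proof
  show "finite (parcs (cycle_blowup d n))"
    by (rule finite_subset[of _ "{..<n} \<times> {..<n}"]) (auto simp: cycle_blowup_def)
  fix e assume "e \<in> parcs (cycle_blowup d n)"
  moreover have "i mod d \<noteq> Suc i mod d" for i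
    using assms by (auto simp: mod_Suc)
  ultimately show "fst e \<noteq> snd e" by (auto simp: cycle_blowup_def)
qed (auto simp: cycle_blowup_def)

lemma cycle_blowup_relpow:
  "(u, v) \<in> parcs (cycle_blowup d n) ^^ m \<Longrightarrow> v mod d = (u + m) mod d"
proof (induction m arbitrary: v)
  case (Suc m)
  from Suc.prems obtain w where uw: "(u, w) \<in> parcs (cycle_blowup d n) ^^ m"
    and wv: "(w, v) \<in> parcs (cycle_blowup d n)" by auto
  have w: "w mod d = (u + m) mod d" "v mod d = Suc w mod d"
    using Suc.IH[OF uw] wv by (simp_all add: cycle_blowup_def)
  have "v mod d = Suc (w mod d) mod d" using w(2) by (simp add: mod_Suc_eq)
  also have "\<dots> = Suc ((u + m) mod d) mod d" by (simp only: w(1))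
  finally show ?case by (simp add: mod_Suc_eq)
qed simp

text \<open>Every arc raises the residue modulo \<open>d\<close> by one, so closed walks have length
  divisible by \<open>d\<close>.\<close>

lemma closed_walks_cycle_blowup_empty:
  assumes "\<not> d dvd l"
  shows "closed_walks (parcs (cycle_blowup d n)) l = {}"
proof (rule ccontr)
  assume *: "closed_walks (parcs (cycle_blowup d n)) l \<noteq> {}"
  have "0 < l" using assms by (intro Nat.gr0I) auto
  from * obtain u where "(u, u) \<in> parcs (cycle_blowup d n) ^^ l"
    unfolding closed_walks_nonempty_iff[OF \<open>0 < l\<close>] by blast
  then have "(u + l) mod d = u mod d" using cycle_blowup_relpow[of u u] by simp
  then have "d dvd (u + l) - u" by (simp only: mod_eq_dvd_iff_nat[OF le_add1])
  then show False using assms by simp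
qed

lemma card_residue_class_ge:
  assumes "0 < d"
  shows "n div d \<le> card {x. x < n \<and> x mod d = c mod d}"
proof -
  have "card {..<n div d} \<le> card {x. x < n \<and> x mod d = c mod d}"
  proof (rule card_inj_on_le[where f = "\<lambda>t. t * d + c mod d"])
    show "inj_on (\<lambda>t. t * d + c mod d) {..<n div d}" using assms by (auto simp: inj_on_def)
    show "(\<lambda>t. t * d + c mod d) ` {..<n div d} \<subseteq> {x. x < n \<and> x mod d = c mod d}"
    proof (rule image_subsetI)
      fix t assume "t \<in> {..<n div d}"
      then have "Suc t * d \<le> n div d * d" by (intro mult_le_mono) auto
      also have "\<dots> \<le> n" by simp
      finally have "t * d + d \<le> n" by simp
      moreover have "c mod d < d" using assms by simp
      ultimately have "t * d + c mod d < n" by linarith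
      then show "t * d + c mod d \<in> {x. x < n \<and> x mod d = c mod d}" by simp
    qed
  qed simp
  then show ?thesis by simp
qed

lemma card_distinct_closed_walks_cycle_blowup:
  assumes "0 < d" "d dvd k" "0 < k"
  shows "d * (n div d - k) ^ k \<le> card {xs \<in> closed_walks (parcs (cycle_blowup d n)) k. distinct xs}"
proof -
  let ?W = "{xs \<in> closed_walks (parcs (cycle_blowup d n)) k. distinct xs}"
  let ?A = "\<lambda>c. {x. x < n \<and> x mod d = c mod d}"
  \<comment> \<open>Cycles starting in class \<open>r\<close>. The \<open>d\<close> starting classes
    give disjoint families.\<close>
  let ?P = "\<lambda>r. {xs. length xs = k \<and> distinct xs \<and> (\<forall>i<k. xs ! i \<in> ?A (r + i))}"
  have "parcs (cycle_blowup d n) \<subseteq> {..<n} \<times> {..<n}" by (auto simp: cycle_blowup_def)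
  then have finW: "finite ?W" using finite_closed_walks[of "{..<n}"] by simp
  have sub: "?P r \<subseteq> ?W" for r
  proof
    fix xs assume "xs \<in> ?P r"
    then have xs: "distinct xs" "\<forall>i<length xs. xs ! i \<in> ?A (r + i)" "k = length xs" by auto
    have "(xs ! i, xs ! (Suc i mod k)) \<in> parcs (cycle_blowup d n)" if "i < k" for i
    proof -
      have "Suc i mod k < length xs" using \<open>0 < k\<close> unfolding xs(3) by simp
      then have *: "xs ! i < n" "xs ! i mod d = (r + i) mod d"
        "xs ! (Suc i mod k) < n" "xs ! (Suc i mod k) mod d = (r + Suc i mod k) mod d"
        using that xs by auto
      have "(r + Suc i mod k) mod d = (r + Suc i mod k mod d) mod d" by (simp add: mod_simps)
      \<comment> \<open>Divisibility of \<open>k\<close> by \<open>d\<close> makes the closing arc,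
        from position \<open>k - 1\<close> back to 0, fit the classes.\<close>
      also have "Suc i mod k mod d = Suc i mod d" using assms by (simp add: mod_mod_cancel)
      also have "(r + Suc i mod d) mod d = Suc (r + i) mod d" by (simp add: mod_simps)
      also have "\<dots> = Suc ((r + i) mod d) mod d" by (rule mod_Suc_eq[symmetric])
      also have "\<dots> = Suc (xs ! i mod d) mod d" by (simp only: *)
      also have "\<dots> = Suc (xs ! i) mod d" by (rule mod_Suc_eq)
      finally show ?thesis using * by (simp add: cycle_blowup_def)
    qed
    then show "xs \<in> ?W" using xs by (simp add: closed_walks_def)
  qed
  have disj: "?P r \<inter> ?P s = {}" if "r < d" "s < d" "r \<noteq> s" for r s
  proof -
    have "xs ! 0 mod d = r" if "xs \<in> ?P r" "r < d" for xs r
      using that \<open>0 < k\<close> by simp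
    then show ?thesis using that by blast
  qed
  have "d * (n div d - k) ^ k = (\<Sum>r<d. (n div d - k) ^ k)" by simp
  also have "\<dots> \<le> (\<Sum>r<d. card (?P r))"
    using card_residue_class_ge[OF assms(1)]
    by (intro sum_mono card_distinct_transversals_ge) auto
  also have "\<dots> = card (\<Union>r<d. ?P r)"
    using disj finite_subset[OF sub finW] by (subst card_UN_disjoint) auto
  also have "\<dots> \<le> card ?W" using sub finW by (intro card_mono) auto
  finally show ?thesis .
qed

lemma max_copies_ge_blowup:
  assumes "2 \<le> d" "d dvd k" "\<not> d dvd l" "0 < k"
  shows "d * (n div d - k) ^ k \<le> k * max_copies (dicycle k) (dicycle l) n"
proof -
  let ?G = "cycle_blowup d n"
  have G: "pair_digraph ?G" using assms by (intro pair_digraph_cycle_blowup)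
  interpret pair_digraph ?G by (fact G)
  have "copies (dicycle l) ?G = {}"
    unfolding copies_dicycle_empty_iff[OF pair_wf_digraph_axioms]
    using closed_walks_cycle_blowup_empty[OF assms(3)] by simp
  moreover have "card (pverts ?G) = n" by (simp add: cycle_blowup_def)
  ultimately have "card (copies (dicycle k) ?G) \<in> free_copy_counts (dicycle k) (dicycle l) n"
    using G by (auto simp: free_copy_counts_def)
  then have "card (copies (dicycle k) ?G) \<le> max_copies (dicycle k) (dicycle l) n"
    unfolding max_copies_def by (intro Max_ge finite_free_copy_counts)
  then have "k * card (copies (dicycle k) ?G) \<le> k * max_copies (dicycle k) (dicycle l) n" by simp
  then show ?thesis
    using card_distinct_closed_walks_cycle_blowup[of d k n] card_copies_dicycle[OF G, of k] assms by simp
qed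

section \<open>Matching the two bounds\<close>

theorem theorem5p1:
  fixes k l d :: nat
  assumes "k \<ge> 3" and "l \<ge> 2 * (k - 1)\<^sup>2" and "\<not> k dvd l"
    and "d = (LEAST d'. 0 < d' \<and> d' dvd k \<and> \<not> d' dvd l)"
  shows "(\<lambda>n. real (max_copies (dicycle k) (dicycle l) n)
            - real n / real k * (real n / real d) ^ (k - 1)) \<in> o(\<lambda>n. real n ^ k)"
proof (rule landau_o.smallI)
  fix c :: real assume c: "0 < c"
  have k: "0 < k" using assms(1) by simp
  have "0 < k \<and> k dvd k \<and> \<not> k dvd l" using assms(3) k by simp
  from LeastI[of "\<lambda>d'. 0 < d' \<and> d' dvd k \<and> \<not> d' dvd l", OF this]
  have d: "0 < d" "d dvd k" "\<not> d dvd l" unfolding assms(4) by blast+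
  \<comment> \<open>1 divides \<open>l\<close>, so \<open>d\<close> is not 1, and the blow-up has no
    loops.\<close>
  have d2: "2 \<le> d" using d by (cases "d = 1") auto
  have l: "0 < l" using d by (intro Nat.gr0I) auto
  have least: "d \<le> g" if "g dvd k" "\<not> g dvd l" for g
    unfolding assms(4)
  proof (rule Least_le)
    have "0 < g" using that(1) k by (intro Nat.gr0I) auto
    then show "0 < g \<and> g dvd k \<and> \<not> g dvd l" using that by simp
  qed
  define a where "a = 1 / real d ^ (k - 1)"
  let ?M = "\<lambda>n. real (max_copies (dicycle k) (dicycle l) n)"
  have main: "real n / real k * (real n / real d) ^ (k - 1) = a / real k * real n ^ k" for n
    using k by (cases k) (simp_all add: a_def power_divide)
  obtain n0 where n0: "\<forall>V E :: nat rel. finite V \<longrightarrow> n0 \<le> card V \<longrightarrow> E \<subseteq> V \<times> V \<longrightarrow> irrefl E \<longrightarrow>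
      (\<forall>xs\<in>closed_walks E l. \<not> distinct xs) \<longrightarrow>
      real (card (closed_walks E k)) \<le> (1 / real d ^ (k - 1) + c) * real (card V) ^ k"
    using closed_walks_asymptotic_bound[OF c assms(2,3) k d(1) least] ..
  have upper: "?M n \<le> (a / real k + c) * real n ^ k" if "n0 \<le> n" for n
  proof -
    have "max_copies (dicycle k) (dicycle l) n \<in> free_copy_counts (dicycle k) (dicycle l) n"
      unfolding max_copies_def
      by (intro Max_in finite_free_copy_counts free_copy_counts_dicycle_nonempty l)
    then obtain G :: "nat pair_pre_digraph" where G: "pair_digraph G" "card (pverts G) = n"
      "copies (dicycle l) G = {}" "max_copies (dicycle k) (dicycle l) n = card (copies (dicycle k) G)"
      by (auto simp: free_copy_counts_def)
    interpret pair_digraph G by (fact G)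
    have sub: "parcs G \<subseteq> pverts G \<times> pverts G" by (auto dest: in_arcsD1 in_arcsD2)
    have irr: "irrefl (parcs G)" using pair_no_loops by (fastforce simp: irrefl_def)
    have no: "\<forall>xs\<in>closed_walks (parcs G) l. \<not> distinct xs"
      using G(3) copies_dicycle_empty_iff[OF pair_wf_digraph_axioms] by blast
    \<comment> \<open>Every copy accounts for \<open>k\<close> closed walks; those with repeated
      vertices only enlarge the right-hand side.\<close>
    have "k * card (copies (dicycle k) G) \<le> card (closed_walks (parcs G) k)"
      unfolding card_copies_dicycle[OF G(1) k]
      by (intro card_mono finite_closed_walks[OF pair_finite_verts sub]) auto
    then have "real k * ?M n \<le> real (card (closed_walks (parcs G) k))"
      unfolding G(4) by (metis of_nat_le_iff of_nat_mult)
    also have "\<dots> \<le> (a + c) * real n ^ k"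
      using n0[rule_format, of "pverts G" "parcs G"] pair_finite_verts sub irr no that G(2)
      by (simp add: a_def)
    finally have "?M n \<le> (a / real k + c / real k) * real n ^ k"
      using k by (simp add: field_simps)
    also have "\<dots> \<le> (a / real k + c) * real n ^ k"
      using c k by (intro mult_right_mono add_left_mono) (auto simp: field_simps)
    finally show ?thesis .
  qed
  \<comment> \<open>The loss \<open>k + 1\<close> consists of 1 for rounding in
    \<open>n div d\<close> and \<open>k\<close> for keeping the vertices distinct.\<close>
  have "(\<lambda>n. (real n / real d - real (k + 1)) / real n) \<longlonglongrightarrow> inverse (real d)"
    using d(1) by real_asymp
  then have "(\<lambda>n. real d / real k * ((real n / real d - real (k + 1)) / real n) ^ k)
      \<longlonglongrightarrow> real d / real k * inverse (real d) ^ k"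
    by (intro tendsto_intros)
  moreover have "real d / real k * inverse (real d) ^ k = a / real k"
    using k d(1) by (cases k) (simp_all add: a_def power_inverse divide_inverse)
  ultimately have "\<forall>\<^sub>F n in sequentially.
      a / real k - c < real d / real k * ((real n / real d - real (k + 1)) / real n) ^ k"
    using c by (intro order_tendstoD(1)) auto
  then show "\<forall>\<^sub>F n in sequentially. norm (?M n - real n / real k * (real n / real d) ^ (k - 1))
      \<le> c * norm (real n ^ k)"
    using eventually_ge_at_top[of n0] eventually_ge_at_top[of "d * (k + 1)"] eventually_gt_at_top[of 0]
  proof eventually_elim
    case (elim n)
    \<comment> \<open>Makes the base below nonnegative, so that taking powers preserves the
      inequality.\<close>
    have n: "real (k + 1) \<le> real n / real d"
    proof -
      have "real (d * (k + 1)) \<le> real n" using elim(3) by (rule of_nat_mono)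
      then show ?thesis using d(1) by (simp add: field_simps)
    qed
    have "real n / real d - real (k + 1) \<le> real (n div d - k)"
    proof -
      have "real n / real d - 1 \<le> real (n div d)"
        using real_of_int_floor_gt_diff_one[of "real n / real d"]
        by (simp add: floor_divide_of_nat_eq)
      then show ?thesis by linarith
    qed
    then have "(real n / real d - real (k + 1)) ^ k \<le> real (n div d - k) ^ k"
      using n by (intro power_mono) auto
    then have "real d * (real n / real d - real (k + 1)) ^ k \<le> real (d * (n div d - k) ^ k)"
      by (simp add: mult_left_mono)
    also have "\<dots> \<le> real k * ?M n"
      using max_copies_ge_blowup[OF d2 d(2,3) k, of n] by (metis of_nat_le_iff of_nat_mult)
    finally have low: "real d / real k * (real n / real d - real (k + 1)) ^ k \<le> ?M n"
      using k by (simp add: field_simps)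
    have "(a / real k - c) * real n ^ k
        \<le> real d / real k * ((real n / real d - real (k + 1)) / real n) ^ k * real n ^ k"
      using elim(1) by (intro mult_right_mono) auto
    also have "\<dots> = real d / real k * (real n / real d - real (k + 1)) ^ k"
      using elim(4) by (simp add: power_divide)
    finally have "(a / real k - c) * real n ^ k \<le> ?M n" using low by simp
    with upper[OF elim(2)] show ?case
      unfolding main by (simp add: abs_le_iff algebra_simps)
  qed
qed

end
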